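(* For every positive integer $n$, there exists a type-$1,2,3,4$ $\mathrm{RPA}(n)$.
   Context: Let $[n]=\{1,\ldots,n\}$. A retransmission permutation array of order $n$ ($\mathrm{RPA}(n)$) of type $1$ is an $n\times n$ array with entries from $[n]$ such that (i) every row is a permutation of $[n]$, and (ii) for each $1\le i\le n$, the $i\times\lceil n/i\rceil$ rectangle ($i$ rows, $\lceil n/i\rceil$ columns) in the upper left corner of the array contains all $n$ symbols. Types $2$, $3$ and $4$ are defined identically except that (ii) is required for the $i\times\lceil n/i\rceil$ rectangles ($i$ rows, $\lceil n/i\rceil$ columns) in, respectively, the upper right, lower left and lower right corners. A type-$1,2,3,4$ $\mathrm{RPA}(n)$ is an array that is simultaneously of types $1$, $2$, $3$ and $4$. *)

theory Defs
  imports Complex_Main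
begin

text \<open>An \<open>n \<times> n\<close> array is a function \<open>A\<close> with \<open>A r c\<close> the entry in row \<open>r\<close> and column \<open>c\<close>;
  rows and columns are numbered from 1 to \<open>n\<close>, row 1 being the top row and column 1 the leftmost
  column. Values of \<open>A\<close> outside these index ranges are irrelevant.\<close>

definition rows_are_permutations :: "nat \<Rightarrow> (nat \<Rightarrow> nat \<Rightarrow> nat) \<Rightarrow> bool" where
  "rows_are_permutations n A \<longleftrightarrow> (\<forall>r\<in>{1..n}. bij_betw (A r) {1..n} {1..n})"

definition contains_all_symbols ::
    "nat \<Rightarrow> (nat \<Rightarrow> nat \<Rightarrow> nat) \<Rightarrow> nat set \<Rightarrow> nat set \<Rightarrow> bool" where
  "contains_all_symbols n A R C \<longleftrightarrow> (\<forall>s\<in>{1..n}. \<exists>r\<in>R. \<exists>c\<in>C. A r c = s)"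

definition rect_width :: "nat \<Rightarrow> nat \<Rightarrow> nat" where
  "rect_width n i = nat \<lceil>real n / real i\<rceil>"

text \<open>For \<open>k \<le> n\<close>, the first \<open>k\<close> indices are \<open>{1..k}\<close> and the last \<open>k\<close> indices are
  \<open>{n - k<..n}\<close>. In the definitions below both \<open>i \<le> n\<close> and \<open>rect_width n i \<le> n\<close>, so the
  subtraction never truncates.\<close>

definition rpa_type1 :: "nat \<Rightarrow> (nat \<Rightarrow> nat \<Rightarrow> nat) \<Rightarrow> bool" where
  "rpa_type1 n A \<longleftrightarrow> rows_are_permutations n A \<and>
     (\<forall>i\<in>{1..n}. contains_all_symbols n A {1..i} {1..rect_width n i})"

definition rpa_type2 :: "nat \<Rightarrow> (nat \<Rightarrow> nat \<Rightarrow> nat) \<Rightarrow> bool" where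
  "rpa_type2 n A \<longleftrightarrow> rows_are_permutations n A \<and>
     (\<forall>i\<in>{1..n}. contains_all_symbols n A {1..i} {n - rect_width n i<..n})"

definition rpa_type3 :: "nat \<Rightarrow> (nat \<Rightarrow> nat \<Rightarrow> nat) \<Rightarrow> bool" where
  "rpa_type3 n A \<longleftrightarrow> rows_are_permutations n A \<and>
     (\<forall>i\<in>{1..n}. contains_all_symbols n A {n - i<..n} {1..rect_width n i})"

definition rpa_type4 :: "nat \<Rightarrow> (nat \<Rightarrow> nat \<Rightarrow> nat) \<Rightarrow> bool" where
  "rpa_type4 n A \<longleftrightarrow> rows_are_permutations n A \<and>
     (\<forall>i\<in>{1..n}. contains_all_symbols n A {n - i<..n} {n - rect_width n i<..n})"

definition rpa_type1234 :: "nat \<Rightarrow> (nat \<Rightarrow> nat \<Rightarrow> nat) \<Rightarrow> bool" where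
  "rpa_type1234 n A \<longleftrightarrow> rpa_type1 n A \<and> rpa_type2 n A \<and> rpa_type3 n A \<and> rpa_type4 n A"

end

theory Submission
  imports Defs
begin

text \<open>Rows, columns and symbols are numbered from 0, and the upper half of the array is filled row by
  row. After \<open>r\<close> rows every symbol \<open>s\<close> has one distinguished occurrence on the left, at row \<open>j\<close> and
  distance \<open>c\<close> from the left border, such that \<open>r * c + j < n\<close>, and similarly on the right.
  As there are exactly \<open>n\<close> such positions \<open>(j, c)\<close>, the corner rectangles of height \<open>r\<close> contain all
  symbols. When row \<open>r\<close> is added, the symbols whose position violates \<open>(r + 1) * c + j < n\<close> have to
  be repeated in the new row. The row can be completed to a permutation if no symbol has to be
  repeated on both sides. This is arranged by never letting the left and the right position of a
  symbol expire at the same row: the number of positions expiring at a later row \<open>t\<close> is at most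
  the number of symbols to be repeated now, because the numbers of repeated symbols decrease
  with the row, and this is precisely what is needed to distribute the symbols over the new
  positions.

  The lower half is the upper half rotated by 180 degrees, with its symbols renamed by a
  permutation chosen such that the first and the last column contain every symbol.
  For odd \<open>n\<close> the middle row is shared by both halves; the renaming then has to exchange the first
  and the last entry of that row, which is possible after exchanging, if necessary, two entries
  of an upper row.\<close>

section \<open>Extending bijections\<close>

text \<open>A bijection with the fewest clashes has none: a clash at \<open>x\<close> is removed by exchanging the images
  of \<open>x\<close> and a suitable \<open>z\<close>, which exists by counting.\<close>

lemma bij_betw_avoiding_types:
  fixes a :: "'a \<Rightarrow> 't" and b :: "'b \<Rightarrow> 't"
  assumes fin: "finite X" "finite Y" and eq: "card X = card Y"
    and few: "\<And>t. t \<in> K \<Longrightarrow> card {x \<in> X. a x = t} + card {y \<in> Y. b y = t} \<le> card X"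
  shows "\<exists>f. bij_betw f X Y \<and> (\<forall>x\<in>X. a x \<in> K \<longrightarrow> b (f x) \<noteq> a x)"
proof -
  define bad where "bad = (\<lambda>f. {x \<in> X. a x \<in> K \<and> b (f x) = a x})"
  have "\<exists>f. bij_betw f X Y"
    using fin eq finite_same_card_bij by blast
  then obtain f where f: "bij_betw f X Y"
    and min: "\<And>g. bij_betw g X Y \<Longrightarrow> card (bad f) \<le> card (bad g)"
    using ex_has_least_nat[of "\<lambda>f. bij_betw f X Y" _ "\<lambda>f. card (bad f)"] by blast
  have "bad f = {}"
  proof (rule ccontr)
    assume "bad f \<noteq> {}"
    then obtain x where x: "x \<in> X" "a x \<in> K" "b (f x) = a x"
      by (auto simp: bad_def)
    define P where "P = {z \<in> X. a z = a x}"
    define Q where "Q = {z \<in> X. b (f z) = a x}"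
    have finPQ: "finite P" "finite Q"
      using fin by (auto simp: P_def Q_def)
    have "card Q = card (f ` Q)"
      using f by (intro card_image[symmetric]) (auto simp: bij_betw_def Q_def inj_on_def)
    also have "\<dots> \<le> card {y \<in> Y. b y = a x}"
      using f fin by (intro card_mono) (auto simp: bij_betw_def Q_def)
    finally have "card P + card Q \<le> card X"
      using few[OF x(2)] by (simp add: P_def)
    \<comment> \<open>The clash \<open>x\<close> is counted in both sets, so the union is strictly
      smaller than \<open>X\<close> and leaves room for \<open>z\<close>.\<close>
    moreover have "x \<in> P \<inter> Q"
      using x by (auto simp: P_def Q_def)
    then have "card (P \<inter> Q) > 0"
      using finPQ by (auto simp: card_gt_0_iff)
    moreover have "card P + card Q = card (P \<union> Q) + card (P \<inter> Q)"
      using finPQ by (rule card_Un_Int)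
    ultimately have "card (P \<union> Q) < card X"
      by linarith
    moreover have "P \<union> Q \<subseteq> X"
      by (auto simp: P_def Q_def)
    ultimately obtain z where z: "z \<in> X" "z \<notin> P" "z \<notin> Q"
      by (metis card_mono finPQ finite_UnI less_irrefl subset_antisym subsetI UnI1 UnI2)
    define g where "g = f(x := f z, z := f x)"
    have "bij_betw g X Y"
    proof -
      have "inj_on f X" "f ` X = Y"
        using f by (auto simp: bij_betw_def)
      then have "inj_on g X" "g ` X \<subseteq> Y"
        using x(1) z(1) by (auto simp: g_def inj_on_def)
      then show ?thesis
        using fin eq by (simp add: bij_betw_def card_image card_subset_eq)
    qed
    \<comment> \<open>The exchange creates no new clash: \<open>x\<close> now gets
      \<open>f z\<close>, whose type is not \<open>a x\<close> because \<open>z\<close> is not in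
      \<open>Q\<close>, and \<open>z\<close> gets \<open>f x\<close> of type \<open>a x\<close>,
      which differs from \<open>a z\<close> because \<open>z\<close> is not in
      \<open>P\<close>.\<close>
    moreover have "bad g \<subset> bad f"
      using x z by (auto simp: bad_def g_def P_def Q_def split: if_splits)
    then have "card (bad g) < card (bad f)"
      using fin by (intro psubset_card_mono) (auto simp: bad_def)
    ultimately show False
      using min by fastforce
  qed
  with f show ?thesis
    by (auto simp: bad_def)
qed

lemma ex_bij_betw_extending:
  assumes "finite N" "D \<subseteq> N" "inj_on g D" "g ` D \<subseteq> N"
  shows "\<exists>p. bij_betw p N N \<and> (\<forall>x\<in>D. p x = g x)"
proof -
  have "card (N - D) = card (N - g ` D)"
    using assms by (simp add: card_Diff_subset finite_subset card_image)
  then obtain k where k: "bij_betw k (N - D) (N - g ` D)"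
    using assms(1) by (meson finite_Diff finite_same_card_bij)
  define p where "p = (\<lambda>x. if x \<in> D then g x else k x)"
  have "bij_betw p D (g ` D)"
    using assms(3) by (auto simp: p_def bij_betw_def inj_on_def)
  moreover have "bij_betw p (N - D) (N - g ` D)"
    using k by (subst bij_betw_cong[where g = k]) (auto simp: p_def)
  ultimately have "bij_betw p (D \<union> (N - D)) (g ` D \<union> (N - g ` D))"
    by (rule bij_betw_combine) auto
  then have "bij_betw p N N"
    using assms(2,4) by (simp add: Un_absorb1 Un_Diff_cancel)
  then show ?thesis
    by (auto simp: p_def)
qed

text \<open>Here \<open>l\<close> and \<open>r\<close> are distances from the left and the right
  border. The hypothesis \<open>cross\<close> keeps every prescribed left column strictly before
  every prescribed right column, so the prescriptions form an injective partial map from symbols to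
  columns, which extends to a permutation.\<close>

lemma ex_row:
  fixes l r :: "nat \<Rightarrow> nat"
  assumes "X \<subseteq> {..<n}" "Y \<subseteq> {..<n}" "X \<inter> Y = {}" "inj_on l X" "inj_on r Y"
    and "\<And>s. s \<in> X \<Longrightarrow> l s < n" "\<And>s. s \<in> Y \<Longrightarrow> r s < n"
    and cross: "\<And>s t. s \<in> X \<Longrightarrow> t \<in> Y \<Longrightarrow> l s + r t < n - 1"
  shows "\<exists>p. bij_betw p {..<n} {..<n} \<and> (\<forall>s\<in>X. p (l s) = s) \<and> (\<forall>s\<in>Y. p (n - 1 - r s) = s)"
proof -
  define q where "q = (\<lambda>s. if s \<in> X then l s else n - 1 - r s)"
  have "inj_on q (X \<union> Y)"
  proof (rule inj_onI)
    fix s t assume st: "s \<in> X \<union> Y" "t \<in> X \<union> Y" "q s = q t"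
    consider "s \<in> X" "t \<in> X" | "s \<in> X" "t \<in> Y" | "s \<in> Y" "t \<in> X" | "s \<in> Y" "t \<in> Y"
      using st by blast
    then show "s = t"
    proof cases
      case 1
      then show ?thesis using st assms by (auto simp: q_def inj_on_def)
    next
      case 2
      then have "t \<notin> X" using assms by blast
      then show ?thesis using 2 st cross[of s t] by (auto simp: q_def)
    next
      case 3
      then have "s \<notin> X" using assms by blast
      then show ?thesis using 3 st cross[of t s] by (auto simp: q_def)
    next
      case 4
      then have "s \<notin> X" "t \<notin> X" using assms by auto
      then have "n - 1 - r s = n - 1 - r t" using st by (auto simp: q_def)
      then have "r s = r t" using 4 assms(7)[of s] assms(7)[of t] by linarith
      then show ?thesis using 4 assms by (auto simp: inj_on_def)
    qed
  qed
  moreover have "q ` (X \<union> Y) \<subseteq> {..<n}"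
    using assms(1,2,6,7) by (fastforce simp: q_def)
  ultimately obtain p where p: "bij_betw p {..<n} {..<n}" "\<And>s. s \<in> X \<union> Y \<Longrightarrow> p s = q s"
    using ex_bij_betw_extending[of "{..<n}" "X \<union> Y" q] assms(1,2) by auto
  \<comment> \<open>\<open>p\<close> sends symbols to columns, whereas a row sends columns to
    symbols.\<close>
  let ?p = "inv_into {..<n} p"
  have inv: "?p (q s) = s" if "s \<in> X \<union> Y" for s
    using that p assms(1,2) by (metis UnE bij_betw_inv_into_left subsetD)
  have "bij_betw ?p {..<n} {..<n}"
    using p(1) by (rule bij_betw_inv_into)
  moreover have "?p (l s) = s" if "s \<in> X" for s
    using inv[of s] that by (simp add: q_def)
  moreover have "?p (n - 1 - r s) = s" if "s \<in> Y" for s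
    using inv[of s] that disjoint_iff[of X Y] assms(3) by (simp add: q_def split: if_splits)
  ultimately show ?thesis by blast
qed

section \<open>Positions and their expiry\<close>

text \<open>When a strip of \<open>r\<close> rows is numbered column by column from the border, row
  \<open>j\<close> at distance \<open>c\<close> gets the number \<open>r * c + j\<close>; these are
  the first \<open>n\<close> places of the strip.\<close>

definition cells :: "nat \<Rightarrow> nat \<Rightarrow> (nat \<times> nat) set" where
  "cells n r = {(j, c). j < r \<and> r * c + j < n}"

text \<open>The first \<open>r\<close> for which the position is no longer in \<open>cells n r\<close>. Positions at the border never
  expire, and this is encoded as 0.\<close>

definition expiry :: "nat \<Rightarrow> nat \<times> nat \<Rightarrow> nat" where
  "expiry n = (\<lambda>(j, c). if c = 0 then 0 else (n - 1 - j) div c + 1)"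

lemma bij_betw_cells:
  assumes "r > 0"
  shows "bij_betw (\<lambda>m. (m mod r, m div r)) {..<n} (cells n r)"
  using assms
  by (intro bij_betw_byWitness[where f' = "\<lambda>(j, c). r * c + j"])
     (auto simp: cells_def)

lemma finite_cells [simp]: "finite (cells n r)"
proof (cases "r = 0")
  case False
  then show ?thesis using bij_betw_finite[OF bij_betw_cells[of r n]] by simp
qed (simp add: cells_def)

lemma card_cells: "r > 0 \<Longrightarrow> card (cells n r) = n"
  using bij_betw_same_card[OF bij_betw_cells[of r n]] by simp

lemma new_cells: "cells n (Suc r) - cells n r = {(j, c). j = r \<and> Suc r * c + r < n}"
  by (auto simp: cells_def)

text \<open>Solving \<open>r * c + j < n\<close> for \<open>r\<close> by division shows that a
  position away from the border is alive on an interval of heights, from the arrival of its row to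
  its expiry.\<close>

lemma mem_cells_iff_expiry:
  assumes "c > 0" "j < n"
  shows "(j, c) \<in> cells n r \<longleftrightarrow> j < r \<and> r < expiry n (j, c)"
proof -
  have "r * c + j < n \<longleftrightarrow> r * c \<le> n - 1 - j"
    using assms by linarith
  also have "\<dots> \<longleftrightarrow> r \<le> (n - 1 - j) div c"
    using assms by (simp add: less_eq_div_iff_mult_less_eq)
  finally show ?thesis
    using assms by (auto simp: cells_def expiry_def)
qed

text \<open>Since lifetimes are intervals, a position alive at height \<open>r\<close> is still
  alive just before its expiry. All positions with expiry \<open>t\<close> are therefore among those
  lost between heights \<open>t - 1\<close> and \<open>t\<close>, where they can be counted.\<close>

lemma expiry_cases:
  assumes "x \<in> cells n r" "expiry n x = t" "t \<noteq> 0"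
  shows "r < t" "x \<in> cells n (t - 1)" "x \<notin> cells n t"
proof -
  obtain j c where x: "x = (j, c)" by force
  have c: "c > 0" using assms(2,3) x by (cases "c = 0") (auto simp: expiry_def)
  have j: "j < n" using assms x by (auto simp: cells_def)
  have mem: "(j, c) \<in> cells n k \<longleftrightarrow> j < k \<and> k < t" for k
    using assms(2) mem_cells_iff_expiry[OF c j, of k] by (simp add: x)
  have "j < r" "r < t"
    using assms(1) mem unfolding x by blast+
  then show "r < t" "x \<in> cells n (t - 1)" "x \<notin> cells n t"
    unfolding x mem by linarith+
qed

lemma expiry_eq_Suc:
  assumes "x \<in> cells n r" "x \<notin> cells n (Suc r)"
  shows "expiry n x = Suc r"
proof -
  obtain j c where x: "x = (j, c)" by force
  have c: "c > 0" using assms x by (cases c) (auto simp: cells_def)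
  have j: "j < n" using assms x by (auto simp: cells_def)
  show ?thesis
    using assms mem_cells_iff_expiry[OF c j, of r] mem_cells_iff_expiry[OF c j, of "Suc r"]
    unfolding x by linarith
qed

text \<open>Both sets of positions have \<open>n\<close> elements, so as many positions are lost as
  are gained.\<close>

lemma card_moving_cells:
  assumes "r > 0"
  shows "card (cells n r - cells n (Suc r)) = card (cells n (Suc r) - cells n r)"
  using assms card_Diff_subset_Int[of "cells n r" "cells n (Suc r)"]
    card_Diff_subset_Int[of "cells n (Suc r)" "cells n r"]
  by (simp add: card_cells Int_commute)

text \<open>A later row admits only smaller distances, so its new positions inject into those of an
  earlier row with the distance kept.\<close>

lemma card_new_cells_antimono:
  assumes "r \<le> r'"
  shows "card (cells n (Suc r') - cells n r') \<le> card (cells n (Suc r) - cells n r)"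
proof -
  have "Suc r * c + r < n" if "Suc r' * c + r' < n" for c
  proof -
    have "Suc r * c + r \<le> Suc r' * c + r'"
      using assms by (intro add_mono mult_right_mono) auto
    with that show ?thesis by linarith
  qed
  then have "(\<lambda>(j, c). (r, c)) ` (cells n (Suc r') - cells n r') \<subseteq> cells n (Suc r) - cells n r"
    unfolding new_cells by auto
  moreover have "inj_on (\<lambda>(j, c). (r, c)) (cells n (Suc r') - cells n r')"
    unfolding new_cells by (auto simp: inj_on_def)
  ultimately show ?thesis
    by (metis card_inj_on_le finite_Diff finite_cells)
qed

text \<open>The positions expiring at \<open>t\<close> are lost at \<open>t\<close>; their number is
  bounded by that of the new positions in row \<open>t - 1\<close>, which is a later row than
  \<open>r\<close>. The bound supplies the counting hypothesis of
  \<open>bij_betw_avoiding_types\<close> when row \<open>r\<close> is added.\<close>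

lemma card_expiry_le:
  assumes "t \<noteq> 0"
  shows "card {x \<in> cells n (Suc r). expiry n x = t} \<le> card (cells n (Suc r) - cells n r)"
proof (cases "{x \<in> cells n (Suc r). expiry n x = t} = {}")
  case False
  then have t: "Suc r < t"
    using expiry_cases(1) assms by blast
  have "card {x \<in> cells n (Suc r). expiry n x = t} \<le> card (cells n (t - 1) - cells n t)"
    using expiry_cases(2,3)[OF _ _ assms] by (intro card_mono finite_Diff finite_cells) blast
  also have "\<dots> = card (cells n (Suc (t - 1)) - cells n (t - 1))"
    using t card_moving_cells[of "t - 1" n] by simp
  also have "\<dots> \<le> card (cells n (Suc r) - cells n r)"
    using t by (intro card_new_cells_antimono) simp
  finally show ?thesis .
next
  case True
  then show ?thesis by (simp only: card.empty le0)
qed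

section \<open>The upper half\<close>

text \<open>For odd \<open>n\<close> the entry of the middle column in row 0 can serve only one of the two sides, here the right
  one. Therefore the left positions count the first two rows in exchanged order.\<close>

definition swap01 :: "nat \<Rightarrow> nat" where
  "swap01 j = (if j = 0 then 1 else if j = 1 then 0 else j)"

text \<open>\<open>L s\<close> and \<open>R s\<close> are the current left and right positions of \<open>s\<close>.\<close>

definition compatible ::
    "nat \<Rightarrow> nat \<Rightarrow> (nat \<Rightarrow> nat \<Rightarrow> nat) \<Rightarrow> (nat \<Rightarrow> nat \<times> nat) \<Rightarrow> (nat \<Rightarrow> nat \<times> nat) \<Rightarrow> bool" where
  "compatible n r A L R \<longleftrightarrow>
     bij_betw L {..<n} (cells n r) \<and> bij_betw R {..<n} (cells n r) \<and>
     (\<forall>s<n. expiry n (L s) \<noteq> 0 \<longrightarrow> expiry n (R s) \<noteq> expiry n (L s)) \<and>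
     (\<forall>j<r. bij_betw (A j) {..<n} {..<n}) \<and>
     (\<forall>s<n. \<forall>j c. L s = (j, c) \<longrightarrow> A (swap01 j) c = s) \<and>
     (\<forall>s<n. \<forall>j c. R s = (j, c) \<longrightarrow> A j (n - 1 - c) = s)"

text \<open>The symbols \<open>X\<close> and \<open>Y\<close> that lose their left or right position
  are disjoint, because a common loss would mean a common expiry. Each side is moved to the new row
  separately while the other side of the moved symbols stays fixed, and \<open>ex_row\<close>
  realises both moves in one row.\<close>

lemma compatible_step:
  assumes comp: "compatible n r A L R" and r: "r \<ge> 2"
  shows "\<exists>p L' R'. compatible n (Suc r) (A(r := p)) L' R'"
proof -
  let ?C = "cells n r" and ?C' = "cells n (Suc r)"
  let ?N = "?C' - ?C"
  have L: "bij_betw L {..<n} ?C" and R: "bij_betw R {..<n} ?C"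
    and noconf: "\<And>s. s < n \<Longrightarrow> expiry n (L s) \<noteq> 0 \<Longrightarrow> expiry n (R s) \<noteq> expiry n (L s)"
    and rows: "\<And>j. j < r \<Longrightarrow> bij_betw (A j) {..<n} {..<n}"
    and AL: "\<And>s j c. s < n \<Longrightarrow> L s = (j, c) \<Longrightarrow> A (swap01 j) c = s"
    and AR: "\<And>s j c. s < n \<Longrightarrow> R s = (j, c) \<Longrightarrow> A j (n - 1 - c) = s"
    using comp by (auto simp: compatible_def)
  define X where "X = {s \<in> {..<n}. L s \<notin> ?C'}"
  define Y where "Y = {s \<in> {..<n}. R s \<notin> ?C'}"
  have XY: "X \<inter> Y = {}"
  proof -
    have False if "s < n" "L s \<notin> ?C'" "R s \<notin> ?C'" for s
    proof -
      have "L s \<in> ?C" "R s \<in> ?C"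
        using that L R by (auto simp: bij_betw_def)
      then show False
        using that expiry_eq_Suc noconf by (metis nat.distinct(1))
    qed
    then show ?thesis by (auto simp: X_def Y_def)
  qed
  \<comment> \<open>Stated for both sides at once: \<open>F\<close> is the side that moves,
    \<open>G\<close> the opposite one, and \<open>Z\<close> the set of symbols whose
    \<open>F\<close> position is lost.\<close>
  have move: "\<exists>F'. bij_betw F' {..<n} ?C' \<and>
       (\<forall>s<n. s \<notin> Z \<longrightarrow> F' s = F s) \<and> (\<forall>s\<in>Z. F' s \<in> ?N) \<and>
       (\<forall>s\<in>Z. expiry n (G s) \<noteq> 0 \<longrightarrow> expiry n (F' s) \<noteq> expiry n (G s))"
    if F: "bij_betw F {..<n} ?C" and G: "bij_betw G {..<n} ?C"
      and Z: "Z = {s \<in> {..<n}. F s \<notin> ?C'}" and GZ: "\<And>s. s \<in> Z \<Longrightarrow> G s \<in> ?C'"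
    for F G Z
  proof -
    have FZ: "bij_betw F Z (?C - ?C')"
      using F by (fastforce simp: Z bij_betw_def inj_on_def)
    have FZc: "bij_betw F ({..<n} - Z) (?C \<inter> ?C')"
      using F by (fastforce simp: Z bij_betw_def inj_on_def)
    have card: "card Z = card ?N"
      using bij_betw_same_card[OF FZ] card_moving_cells[of r n] r by simp
    \<comment> \<open>\<open>G\<close> maps \<open>Z\<close> injectively into surviving old
      positions. Together with the new ones they are distinct positions of \<open>?C'\<close>, so
      \<open>card_expiry_le\<close> bounds both counts jointly.\<close>
    have few: "card {s \<in> Z. expiry n (G s) = t} + card {x \<in> ?N. expiry n x = t} \<le> card Z"
      if "t \<in> {t. t \<noteq> 0}" for t
    proof -
      have "card {s \<in> Z. expiry n (G s) = t} \<le> card {x \<in> ?C \<inter> ?C'. expiry n x = t}"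
      proof (rule card_inj_on_le[where f = G])
        show "inj_on G {s \<in> Z. expiry n (G s) = t}"
          using G by (auto simp: bij_betw_def inj_on_def Z)
        show "G ` {s \<in> Z. expiry n (G s) = t} \<subseteq> {x \<in> ?C \<inter> ?C'. expiry n x = t}"
          using G GZ by (auto simp: bij_betw_def Z)
      qed auto
      moreover have "card {x \<in> ?C \<inter> ?C'. expiry n x = t} + card {x \<in> ?N. expiry n x = t}
          = card ({x \<in> ?C \<inter> ?C'. expiry n x = t} \<union> {x \<in> ?N. expiry n x = t})"
        by (rule card_Un_disjoint[symmetric]) auto
      moreover have "card ({x \<in> ?C \<inter> ?C'. expiry n x = t} \<union> {x \<in> ?N. expiry n x = t})
          \<le> card {x \<in> ?C'. expiry n x = t}"
        by (rule card_mono) auto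
      moreover have "card {x \<in> ?C'. expiry n x = t} \<le> card ?N"
        using that by (intro card_expiry_le) simp
      ultimately show ?thesis
        using card by linarith
    qed
    have "finite Z" by (simp add: Z)
    then obtain f where f: "bij_betw f Z ?N"
        "\<And>s. s \<in> Z \<Longrightarrow> expiry n (G s) \<noteq> 0 \<Longrightarrow> expiry n (f s) \<noteq> expiry n (G s)"
      using bij_betw_avoiding_types[of Z ?N "{t. t \<noteq> 0}" "\<lambda>s. expiry n (G s)" "expiry n"] card few
      by auto
    define F' where "F' = (\<lambda>s. if s \<in> Z then f s else F s)"
    have "bij_betw F' Z ?N"
      using f(1) by (subst bij_betw_cong[where g = f]) (auto simp: F'_def)
    moreover have "bij_betw F' ({..<n} - Z) (?C \<inter> ?C')"
      using FZc by (subst bij_betw_cong[where g = F]) (auto simp: F'_def)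
    ultimately have "bij_betw F' (Z \<union> ({..<n} - Z)) (?N \<union> (?C \<inter> ?C'))"
      by (rule bij_betw_combine) auto
    moreover have "Z \<union> ({..<n} - Z) = {..<n}" "?N \<union> (?C \<inter> ?C') = ?C'"
      by (auto simp: Z)
    ultimately have "bij_betw F' {..<n} ?C'"
      by simp
    moreover have "\<forall>s\<in>Z. F' s \<in> ?N"
      using f(1) by (auto simp: F'_def bij_betw_def)
    moreover have "\<forall>s\<in>Z. expiry n (G s) \<noteq> 0 \<longrightarrow> expiry n (F' s) \<noteq> expiry n (G s)"
      using f(2) by (simp add: F'_def)
    ultimately show ?thesis
      by (intro exI[of _ F']) (simp add: F'_def)
  qed
  obtain L' where L': "bij_betw L' {..<n} ?C'" "\<And>s. s < n \<Longrightarrow> s \<notin> X \<Longrightarrow> L' s = L s"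
      "\<And>s. s \<in> X \<Longrightarrow> L' s \<in> ?N"
      "\<And>s. s \<in> X \<Longrightarrow> expiry n (R s) \<noteq> 0 \<Longrightarrow> expiry n (L' s) \<noteq> expiry n (R s)"
    using move[OF L R X_def] XY by (fastforce simp: X_def Y_def)
  obtain R' where R': "bij_betw R' {..<n} ?C'" "\<And>s. s < n \<Longrightarrow> s \<notin> Y \<Longrightarrow> R' s = R s"
      "\<And>s. s \<in> Y \<Longrightarrow> R' s \<in> ?N"
      "\<And>s. s \<in> Y \<Longrightarrow> expiry n (L s) \<noteq> 0 \<Longrightarrow> expiry n (R' s) \<noteq> expiry n (L s)"
    using move[OF R L Y_def] XY by (fastforce simp: X_def Y_def)
  \<comment> \<open>A symbol moves on at most one side, so the comparison is always with an
    unchanged opposite position.\<close>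
  have noconf': "expiry n (R' s) \<noteq> expiry n (L' s)" if "s < n" "expiry n (L' s) \<noteq> 0" for s
    using that XY L'(2,4) R'(2,4) noconf by (metis disjoint_iff)
  have newX: "fst (L' s) = r \<and> Suc r * snd (L' s) + r < n" if "s \<in> X" for s
    using L'(3)[OF that] unfolding new_cells by auto
  have newY: "fst (R' s) = r \<and> Suc r * snd (R' s) + r < n" if "s \<in> Y" for s
    using R'(3)[OF that] unfolding new_cells by auto
  \<comment> \<open>From \<open>r \<ge> 2\<close>: new positions stay within the half of the row on
    their own side, so left and right ones cannot meet.\<close>
  have double: "2 * c + 1 < n" if "Suc r * c + r < n" for c
    using that r mult_le_mono1[of 2 "Suc r" c] by linarith
  have "\<exists>p. bij_betw p {..<n} {..<n} \<and> (\<forall>s\<in>X. p (snd (L' s)) = s) \<and>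
      (\<forall>s\<in>Y. p (n - 1 - snd (R' s)) = s)"
  proof (rule ex_row)
    show "X \<subseteq> {..<n}" "Y \<subseteq> {..<n}" "X \<inter> Y = {}"
      using XY by (auto simp: X_def Y_def)
    show "inj_on (\<lambda>s. snd (L' s)) X"
      using L'(1) newX by (auto simp: inj_on_def bij_betw_def X_def prod_eq_iff)
    show "inj_on (\<lambda>s. snd (R' s)) Y"
      using R'(1) newY by (auto simp: inj_on_def bij_betw_def Y_def prod_eq_iff)
    show "snd (L' s) < n" if "s \<in> X" for s
      using newX[OF that] double by fastforce
    show "snd (R' s) < n" if "s \<in> Y" for s
      using newY[OF that] double by fastforce
    show "snd (L' s) + snd (R' t) < n - 1" if "s \<in> X" "t \<in> Y" for s t
      using newX[OF that(1)] newY[OF that(2)] double[of "snd (L' s)"] double[of "snd (R' t)"] by linarith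
  qed
  then obtain p where p: "bij_betw p {..<n} {..<n}" "\<And>s. s \<in> X \<Longrightarrow> p (snd (L' s)) = s"
      "\<And>s. s \<in> Y \<Longrightarrow> p (n - 1 - snd (R' s)) = s"
    by blast
  have "compatible n (Suc r) (A(r := p)) L' R'"
    unfolding compatible_def
  proof (intro conjI allI impI)
    show "bij_betw L' {..<n} ?C'" "bij_betw R' {..<n} ?C'"
      by fact+
    show "expiry n (R' s) \<noteq> expiry n (L' s)" if "s < n" "expiry n (L' s) \<noteq> 0" for s
      using that by (rule noconf')
    show "bij_betw ((A(r := p)) j) {..<n} {..<n}" if "j < Suc r" for j
      using that rows p(1) by (cases "j = r") auto
    show "(A(r := p)) (swap01 j) c = s" if "s < n" "L' s = (j, c)" for s j c
    proof (cases "s \<in> X")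
      case True
      \<comment> \<open>The exchange of rows 0 and 1 fixes the new row, as
        \<open>r \<ge> 2\<close>.\<close>
      then have "j = r" using newX that by fastforce
      then show ?thesis using True p(2)[OF True] that r by (simp add: swap01_def)
    next
      case False
      then have Ls: "L s = (j, c)" using L'(2) that by simp
      then have "(j, c) \<in> cells n r" using L that by (metis bij_betwE lessThan_iff)
      then have "swap01 j \<noteq> r" using r by (auto simp: swap01_def cells_def)
      then show ?thesis using AL[OF that(1) Ls] by simp
    qed
    show "(A(r := p)) j (n - 1 - c) = s" if "s < n" "R' s = (j, c)" for s j c
    proof (cases "s \<in> Y")
      case True
      then have "j = r" using newY that by fastforce
      then show ?thesis using True p(3)[OF True] that r by simp
    next
      case False
      then have Rs: "R s = (j, c)" using R'(2) that by simp
      then have "(j, c) \<in> cells n r" using R that by (metis bij_betwE lessThan_iff)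
      then have "j \<noteq> r" by (auto simp: cells_def)
      then show ?thesis using AR[OF that(1) Rs] by simp
    qed
  qed
  then show ?thesis by blast
qed

text \<open>The distances of positions in row \<open>j\<close> expiring at \<open>t\<close> lie in
  an interval from \<open>a\<close> to below \<open>2 * a\<close>. Subtracting \<open>a\<close>
  injects them into the remaining positions of the row, so they make up at most half of it.\<close>

lemma few_equal_expiries_in_row:
  assumes "t \<noteq> 0"
  shows "2 * card {x \<in> cells n 2. fst x = j \<and> expiry n x = t} \<le> card {x \<in> cells n 2. fst x = j}"
    (is "2 * card ?B \<le> card ?E")
proof (cases "?B = {}")
  case False
  then have t: "2 < t"
    using expiry_cases(1)[OF _ _ assms] by blast
  \<comment> \<open>The smallest distance in row \<open>j\<close> that is no longer alive at height
    \<open>t\<close>.\<close>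
  define a where "a = (LEAST c. n \<le> t * c + j)"
  have a: "n \<le> t * a + j"
    unfolding a_def
  proof (rule LeastI)
    show "n \<le> t * n + j" using t by (simp add: trans_le_add1)
  qed
  have B: "snd x < 2 * a \<and> a \<le> snd x \<and> fst x = j \<and> 2 * snd x + j < n" if x: "x \<in> ?B" for x
  proof -
    obtain c where c: "x = (j, c)" using x by (cases x) auto
    have e: "(t - 1) * c + j < n" "n \<le> t * c + j" "2 * c + j < n" "j < 2"
      using x expiry_cases[of x n 2 t] t unfolding c by (auto simp: cells_def)
    have "a \<le> c"
      unfolding a_def using e(2) by (rule Least_le)
    moreover have "c < 2 * a"
    proof (rule ccontr)
      assume "\<not> c < 2 * a"
      then have "(t - 1) * (2 * a) \<le> (t - 1) * c" by simp
      \<comment> \<open>A distance of at least \<open>2 * a\<close> would already have been lost at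
        height \<open>t - 1\<close>, since \<open>2 * (t - 1) \<ge> t\<close>.\<close>
      moreover have "(t - 1) * (2 * a) = t * a + (t - 2) * a"
      proof -
        obtain u where "t = u + 2" using t by (metis add.commute le_Suc_ex less_imp_le)
        then show ?thesis by (simp add: algebra_simps)
      qed
      ultimately show False using e(1) a by linarith
    qed
    ultimately show ?thesis using e c by simp
  qed
  have "card ?B \<le> card (?E - ?B)"
  proof (rule card_inj_on_le[where f = "\<lambda>(i, c). (i, c - a)"])
    show "inj_on (\<lambda>(i, c). (i, c - a)) ?B"
    proof (rule inj_onI)
      fix x y assume "x \<in> ?B" "y \<in> ?B"
        and eq: "(case x of (i, c) \<Rightarrow> (i, c - a)) = (case y of (i, c) \<Rightarrow> (i, c - a))"
      then have "a \<le> snd x" "a \<le> snd y" using B by blast+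
      with eq show "x = y" by (cases x; cases y) auto
    qed
    show "(\<lambda>(i, c). (i, c - a)) ` ?B \<subseteq> ?E - ?B"
    proof (rule image_subsetI)
      fix x assume x: "x \<in> ?B"
      obtain c where c: "x = (j, c)" using x by (cases x) auto
      have "(j, c - a) \<in> ?E" using x B[OF x] c by (auto simp: cells_def)
      moreover have "(j, c - a) \<notin> ?B" using B[of "(j, c - a)"] B[OF x] c by auto
      ultimately show "(case x of (i, c) \<Rightarrow> (i, c - a)) \<in> ?E - ?B" using c by simp
    qed
  qed simp
  moreover have "card ?E = card ?B + card (?E - ?B)"
  proof -
    have "card (?B \<union> (?E - ?B)) = card ?B + card (?E - ?B)"
      by (rule card_Un_disjoint) auto
    moreover have "?B \<union> (?E - ?B) = ?E" by blast
    ultimately show ?thesis by simp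
  qed
  ultimately show ?thesis by linarith
next
  case True
  then show ?thesis by (simp only: card.empty mult_0_right le0)
qed

text \<open>\<open>R\<close> is arbitrary, and \<open>L\<close> is obtained from it by permuting the
  positions within each row so that no nonzero expiry is kept. The two positions of a symbol then
  have the same row number; since the left side counts the rows in exchanged order, they lie in
  different rows of the array, as \<open>ex_row\<close> requires.\<close>

lemma compatible_two:
  assumes "n \<ge> 2"
  shows "\<exists>A L R. compatible n 2 A L R"
proof -
  let ?E = "\<lambda>j. {x \<in> cells n 2. fst x = j}"
  obtain R where R: "bij_betw R {..<n} (cells n 2)"
    using finite_same_card_bij[of "{..<n}" "cells n 2"] by (auto simp: card_cells)
  have ex: "\<exists>f. bij_betw f (?E j) (?E j) \<and>
      (\<forall>x\<in>?E j. expiry n x \<in> {t. t \<noteq> 0} \<longrightarrow> expiry n (f x) \<noteq> expiry n x)" for j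
  proof (rule bij_betw_avoiding_types)
    fix t :: nat assume "t \<in> {t. t \<noteq> 0}"
    then show "card {x \<in> ?E j. expiry n x = t} + card {x \<in> ?E j. expiry n x = t} \<le> card (?E j)"
      using few_equal_expiries_in_row[of t n j] by (simp add: conj_assoc)
  qed auto
  have "\<exists>f. \<forall>j. bij_betw (f j) (?E j) (?E j) \<and>
      (\<forall>x\<in>?E j. expiry n x \<in> {t. t \<noteq> 0} \<longrightarrow> expiry n (f j x) \<noteq> expiry n x)"
    by (rule choice, rule allI, rule ex)
  then obtain f where f: "\<And>j. bij_betw (f j) (?E j) (?E j)"
      "\<And>j x. x \<in> ?E j \<Longrightarrow> expiry n x \<in> {t. t \<noteq> 0} \<Longrightarrow> expiry n (f j x) \<noteq> expiry n x"
    by blast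
  define g where "g = (\<lambda>x. f (fst x) x)"
  have g_cells: "g x \<in> cells n 2" and g_fst: "fst (g x) = fst x" if "x \<in> cells n 2" for x
  proof -
    have "f (fst x) x \<in> ?E (fst x)"
      using bij_betwE[OF f(1)[of "fst x"]] that by blast
    then show "g x \<in> cells n 2" "fst (g x) = fst x" by (auto simp: g_def)
  qed
  have "inj_on g (cells n 2)"
  proof (rule inj_onI)
    fix x y assume xy: "x \<in> cells n 2" "y \<in> cells n 2" "g x = g y"
    then have "fst x = fst y" by (metis g_fst)
    then show "x = y"
      using xy inj_onD[OF bij_betw_imp_inj_on[OF f(1)[of "fst x"]], of x y] by (simp add: g_def)
  qed
  then have g: "bij_betw g (cells n 2) (cells n 2)"
    using g_cells by (intro bij_betw_imageI endo_inj_surj) auto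
  define L where "L = g \<circ> R"
  have L: "bij_betw L {..<n} (cells n 2)"
    unfolding L_def using R g by (rule bij_betw_trans)
  have R_cells: "R s \<in> cells n 2" if "s < n" for s
    using R that by (auto simp: bij_betw_def)
  have L_cells: "L s \<in> cells n 2" if "s < n" for s
    using L that by (auto simp: bij_betw_def)
  have fst_eq: "fst (L s) = fst (R s)" if "s < n" for s
    using g_fst R_cells that by (simp add: L_def)
  have row: "\<exists>p. bij_betw p {..<n} {..<n} \<and>
      (\<forall>s\<in>{s. s < n \<and> fst (L s) = j}. p (snd (L s)) = s) \<and>
      (\<forall>s\<in>{s. s < n \<and> fst (R s) = k}. p (n - 1 - snd (R s)) = s)"
    if jk: "j \<noteq> k" for j k
  proof (rule ex_row)
    show "{s. s < n \<and> fst (L s) = j} \<inter> {s. s < n \<and> fst (R s) = k} = {}"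
      using fst_eq jk by auto
    show "inj_on (\<lambda>s. snd (L s)) {s. s < n \<and> fst (L s) = j}"
      using L by (auto simp: inj_on_def bij_betw_def prod_eq_iff)
    show "inj_on (\<lambda>s. snd (R s)) {s. s < n \<and> fst (R s) = k}"
      using R by (auto simp: inj_on_def bij_betw_def prod_eq_iff)
    show "snd (L s) < n" if "s \<in> {s. s < n \<and> fst (L s) = j}" for s
      using L_cells[of s] that by (auto simp: cells_def)
    show "snd (R s) < n" if "s \<in> {s. s < n \<and> fst (R s) = k}" for s
      using R_cells[of s] that by (auto simp: cells_def)
    \<comment> \<open>Adding \<open>2 * c + j < n\<close> and \<open>2 * d + k < n\<close> with
      \<open>j + k \<ge> 1\<close> yields \<open>c + d < n - 1\<close>. With row number 0 on both
      sides and odd \<open>n\<close>, both could claim the middle column.\<close>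
    show "snd (L s) + snd (R t) < n - 1"
      if "s \<in> {s. s < n \<and> fst (L s) = j}" "t \<in> {s. s < n \<and> fst (R s) = k}" for s t
      using L_cells[of s] R_cells[of t] that jk by (auto simp: cells_def)
  qed auto
  obtain p0 where p0: "bij_betw p0 {..<n} {..<n}"
      "\<And>s. s < n \<Longrightarrow> fst (L s) = 1 \<Longrightarrow> p0 (snd (L s)) = s"
      "\<And>s. s < n \<Longrightarrow> fst (R s) = 0 \<Longrightarrow> p0 (n - 1 - snd (R s)) = s"
    using row[of 1 0] by auto
  obtain p1 where p1: "bij_betw p1 {..<n} {..<n}"
      "\<And>s. s < n \<Longrightarrow> fst (L s) = 0 \<Longrightarrow> p1 (snd (L s)) = s"
      "\<And>s. s < n \<Longrightarrow> fst (R s) = 1 \<Longrightarrow> p1 (n - 1 - snd (R s)) = s"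
    using row[of 0 1] by auto
  define A where "A = (\<lambda>j::nat. if j = 0 then p0 else p1)"
  have "compatible n 2 A L R"
    unfolding compatible_def
  proof (intro conjI allI impI)
    show "bij_betw L {..<n} (cells n 2)" "bij_betw R {..<n} (cells n 2)"
      by fact+
    show "expiry n (R s) \<noteq> expiry n (L s)" if "s < n" "expiry n (L s) \<noteq> 0" for s
      using f(2)[of "R s" "fst (R s)"] R_cells[of s] that by (auto simp: L_def g_def)
    show "bij_betw (A j) {..<n} {..<n}" for j
      using p0(1) p1(1) by (simp add: A_def)
    show "A (swap01 j) c = s" if "s < n" "L s = (j, c)" for s j c
    proof -
      have "j < 2" using L_cells[of s] that by (auto simp: cells_def)
      then show ?thesis
        using p0(2)[of s] p1(2)[of s] that by (auto simp: A_def swap01_def less_2_cases_iff)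
    qed
    show "A j (n - 1 - c) = s" if "s < n" "R s = (j, c)" for s j c
    proof -
      have "j < 2" using R_cells[of s] that by (auto simp: cells_def)
      then show ?thesis
        using p0(3)[of s] p1(3)[of s] that by (auto simp: A_def less_2_cases_iff)
    qed
  qed
  then show ?thesis by blast
qed

section \<open>Covering of corner rectangles\<close>

definition covers :: "nat \<Rightarrow> (nat \<Rightarrow> nat \<Rightarrow> nat) \<Rightarrow> nat \<Rightarrow> bool" where
  "covers n A i \<longleftrightarrow> (\<forall>s<n. \<exists>r<i. \<exists>c. i * c < n \<and> A r c = s)"

text \<open>Together with \<open>flip\<close> below this brings every corner to the upper left, so
  that \<open>covers\<close> has to speak about that corner only.\<close>

definition mirror :: "nat \<Rightarrow> (nat \<Rightarrow> nat \<Rightarrow> nat) \<Rightarrow> nat \<Rightarrow> nat \<Rightarrow> nat" where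
  "mirror n A = (\<lambda>r c. A r (n - 1 - c))"

lemma coversI: "(\<And>s. s < n \<Longrightarrow> \<exists>r<i. \<exists>c. i * c < n \<and> A r c = s) \<Longrightarrow> covers n A i"
  by (simp add: covers_def)

lemma coversE:
  assumes "covers n A i" "s < n"
  obtains r c where "r < i" "i * c < n" "A r c = s"
  using assms by (auto simp: covers_def)

lemma covers_cong:
  assumes "covers n A i" "\<And>r c. r < i \<Longrightarrow> i * c < n \<Longrightarrow> B r c = A r c"
  shows "covers n B i"
proof (rule coversI)
  fix s assume "s < n"
  with assms(1) obtain r c where "r < i" "i * c < n" "A r c = s"
    by (rule coversE)
  with assms(2) show "\<exists>r<i. \<exists>c. i * c < n \<and> B r c = s"
    by blast
qed

lemma swap01_less: "r \<ge> 2 \<Longrightarrow> j < r \<Longrightarrow> swap01 j < r"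
  by (simp add: swap01_def)

lemma compatible_covers:
  assumes "compatible n r A L R" "r \<ge> 2"
  shows "covers n A r" "covers n (mirror n A) r"
proof -
  show "covers n A r"
  proof (rule coversI)
    fix s assume s: "s < n"
    obtain j c where Ls: "L s = (j, c)" by force
    have "(j, c) \<in> cells n r"
      using assms(1) s Ls by (metis bij_betwE compatible_def lessThan_iff)
    then have "swap01 j < r" "r * c < n"
      using swap01_less[OF assms(2)] by (auto simp: cells_def)
    moreover have "A (swap01 j) c = s"
      using assms(1) s Ls by (simp add: compatible_def)
    ultimately show "\<exists>j<r. \<exists>c. r * c < n \<and> A j c = s"
      by blast
  qed
  show "covers n (mirror n A) r"
  proof (rule coversI)
    fix s assume s: "s < n"
    obtain j c where Rs: "R s = (j, c)" by force
    have "(j, c) \<in> cells n r"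
      using assms(1) s Rs by (metis bij_betwE compatible_def lessThan_iff)
    then have "j < r" "r * c < n"
      by (auto simp: cells_def)
    moreover have "mirror n A j c = s"
      using assms(1) s Rs by (simp add: compatible_def mirror_def)
    ultimately show "\<exists>j<r. \<exists>c. r * c < n \<and> mirror n A j c = s"
      by blast
  qed
qed

lemma ex_compatible:
  assumes "n \<ge> 2" "r \<ge> 2"
  shows "\<exists>A L R. compatible n r A L R \<and> (\<forall>i\<in>{2..r}. covers n A i \<and> covers n (mirror n A) i)"
  using assms(2)
proof (induction r rule: dec_induct)
  case base
  then show ?case
    using compatible_two[OF assms(1)] compatible_covers by fastforce
next
  case (step r)
  then obtain A L R where A: "compatible n r A L R"
      "\<And>i. i \<in> {2..r} \<Longrightarrow> covers n A i \<and> covers n (mirror n A) i"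
    by blast
  obtain p L' R' where p: "compatible n (Suc r) (A(r := p)) L' R'"
    using compatible_step[OF A(1)] step by blast
  have "covers n (A(r := p)) i \<and> covers n (mirror n (A(r := p))) i" if "i \<in> {2..Suc r}" for i
  proof (cases "i = Suc r")
    case True
    then show ?thesis using compatible_covers[OF p] step by simp
  next
    case False
    then have i: "i \<in> {2..r}" using that by auto
    \<comment> \<open>Covering at height \<open>i\<close> looks only at rows before
      \<open>i\<close>, which the new row leaves untouched.\<close>
    then have same: "(A(r := p)) j = A j" if "j < i" for j using that by auto
    have "covers n (A(r := p)) i"
      by (rule covers_cong[OF A(2)[OF i, THEN conjunct1]]) (simp only: same)
    moreover have "covers n (mirror n (A(r := p))) i"
      by (rule covers_cong[OF A(2)[OF i, THEN conjunct2]]) (simp only: mirror_def same)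
    ultimately show ?thesis by blast
  qed
  with p show ?case by blast
qed

text \<open>At height \<open>H\<close> the exchange of rows 0 and 1 maps \<open>cells n H\<close>
  onto itself. It can therefore be undone on the left, giving both sides the same form.\<close>

lemma ex_top_half:
  assumes n: "n \<ge> 4" and h: "h = n div 2" and H: "H = n - h"
  shows "\<exists>A. (\<forall>j<H. bij_betw (A j) {..<n} {..<n}) \<and>
    (\<forall>i\<in>{2..H}. covers n A i \<and> covers n (mirror n A) i) \<and>
    bij_betw (\<lambda>(j, c). A j c) (cells n H) {..<n} \<and>
    bij_betw (\<lambda>(j, c). mirror n A j c) (cells n H) {..<n}"
proof -
  have H2: "H \<ge> 2" and n2: "n \<ge> 2" using n h H by auto
  obtain A L R where comp: "compatible n H A L R"
      and cov: "\<forall>i\<in>{2..H}. covers n A i \<and> covers n (mirror n A) i"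
    using ex_compatible[OF n2 H2] by blast
  have L: "bij_betw L {..<n} (cells n H)" and R: "bij_betw R {..<n} (cells n H)"
    and rows: "\<forall>j<H. bij_betw (A j) {..<n} {..<n}"
    and AL: "\<And>s j c. s < n \<Longrightarrow> L s = (j, c) \<Longrightarrow> A (swap01 j) c = s"
    and AR: "\<And>s j c. s < n \<Longrightarrow> R s = (j, c) \<Longrightarrow> A j (n - 1 - c) = s"
    using comp by (auto simp: compatible_def)
  have bij: "bij_betw f (cells n H) {..<n}"
    if "bij_betw F {..<n} (cells n H)" "\<And>s. s < n \<Longrightarrow> f (F s) = s" for f F
  proof (rule bij_betw_byWitness[where f' = F])
    have F: "F ` {..<n} = cells n H" using that(1) by (simp add: bij_betw_def)
    show "\<forall>x\<in>cells n H. F (f x) = x" "f ` cells n H \<subseteq> {..<n}"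
      unfolding F[symmetric] using that(2) by auto
    show "\<forall>s\<in>{..<n}. f (F s) = s" "F ` {..<n} \<subseteq> cells n H"
      using that(2) F by auto
  qed
  have "bij_betw (\<lambda>(j, c). mirror n A j c) (cells n H) {..<n}"
    using R AR by (intro bij) (auto simp: mirror_def split: prod.split)
  moreover have "bij_betw (\<lambda>(j, c). A j c) (cells n H) {..<n}"
  proof -
    let ?w = "\<lambda>(j, c). (swap01 j, c :: nat)"
    have "?w x \<in> cells n H" if "x \<in> cells n H" for x
    proof -
      obtain j c where x: "x = (j, c)" by force
      have "H * c + j < n" "j < H" using that by (auto simp: x cells_def)
      \<comment> \<open>Only the distances 0 and 1 occur at this height, and
        \<open>n - H \<ge> 2\<close> because \<open>n \<ge> 4\<close>.\<close>
      moreover have "H * c + 1 < n" if "H * c + 0 < n"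
      proof -
        have "c = 0 \<or> c = 1"
        proof (rule ccontr)
          assume "\<not> (c = 0 \<or> c = 1)"
          then have "H * 2 \<le> H * c" by simp
          then show False using that h H by linarith
        qed
        then show ?thesis using n h H by auto
      qed
      ultimately show ?thesis using H2 by (auto simp: x cells_def swap01_def)
    qed
    moreover have "?w (?w x) = x" for x
      by (auto simp: swap01_def split: prod.split)
    ultimately have "bij_betw ?w (cells n H) (cells n H)"
      by (intro bij_betw_byWitness[where f' = ?w]) auto
    moreover have "bij_betw (\<lambda>(j, c). A (swap01 j) c) (cells n H) {..<n}"
      using L AL by (intro bij) (auto split: prod.split)
    ultimately have "bij_betw ((\<lambda>(j, c). A (swap01 j) c) \<circ> ?w) (cells n H) {..<n}"
      by (rule bij_betw_trans)
    moreover have "(\<lambda>(j, c). A (swap01 j) c) \<circ> ?w = (\<lambda>(j, c). A j c)"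
      by (auto simp: swap01_def fun_eq_iff)
    ultimately show ?thesis by simp
  qed
  ultimately show ?thesis using rows cov by blast
qed

section \<open>Gluing the two halves\<close>

text \<open>Exchange \<open>T \<inter> U\<close> with the complement of \<open>T \<union> U\<close>, and fix everything else.\<close>

lemma ex_complementing_bij:
  assumes "finite Z" "T \<subseteq> Z" "U \<subseteq> Z" "card T + card U = card Z"
  shows "\<exists>f. bij_betw f Z Z \<and> f ` U = Z - T \<and> f ` T = Z - U"
proof -
  let ?I = "T \<inter> U" and ?O = "Z - (T \<union> U)"
  have fin: "finite T" "finite U"
    using assms finite_subset by auto
  have "card (T \<union> U) + card ?I = card Z"
    using assms(4) card_Un_Int[OF fin] by simp
  moreover have "card (T \<union> U) + card ?O = card Z"
    using assms(1-3) fin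
    by (metis Un_least card_Diff_subset card_mono finite_UnI le_add_diff_inverse)
  ultimately have "card ?I = card ?O" by linarith
  then obtain g where g: "bij_betw g ?I ?O"
    using assms(1) fin by (meson finite_Diff finite_Int finite_same_card_bij)
  define f where "f = (\<lambda>x. if x \<in> ?I then g x else if x \<in> ?O then inv_into ?I g x else x)"
  have fI: "f x \<in> ?O" "f (f x) = x" if "x \<in> ?I" for x
    using that g by (auto simp: f_def bij_betw_def)
  have fO: "f x \<in> ?I" "f (f x) = x" if x: "x \<in> ?O" for x
  proof -
    have *: "inv_into ?I g x \<in> ?I" "g (inv_into ?I g x) = x"
      using x g inv_into_into[of x g ?I] f_inv_into_f[of x g ?I] by (simp_all add: bij_betw_def)
    have "f x = inv_into ?I g x" using x by (auto simp: f_def)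
    with * show "f x \<in> ?I" "f (f x) = x" by (auto simp: f_def)
  qed
  have fid: "f x = x" if "x \<notin> ?I" "x \<notin> ?O" for x
    using that by (auto simp: f_def)
  have inv: "f (f x) = x" for x
    using fI(2) fO(2) fid by metis
  have UT: "f x \<in> Z - T" if "x \<in> U" for x
    using fI(1)[of x] fid[of x] that assms by (cases "x \<in> T") auto
  have TU: "f x \<in> Z - U" if "x \<in> T" for x
    using fI(1)[of x] fid[of x] that assms by (cases "x \<in> U") auto
  have UT': "f x \<in> U" if "x \<in> Z - T" for x
    using fO(1)[of x] fid[of x] that by (cases "x \<in> U") auto
  have TU': "f x \<in> T" if "x \<in> Z - U" for x
    using fO(1)[of x] fid[of x] that by (cases "x \<in> T") auto
  \<comment> \<open>Because \<open>f\<close> is an involution, an image equation follows from the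
    two inclusions \<open>P\<close> into \<open>Q\<close> and \<open>Q\<close> into
    \<open>P\<close>.\<close>
  have img: "f ` P = Q" if "\<And>x. x \<in> P \<Longrightarrow> f x \<in> Q" "\<And>x. x \<in> Q \<Longrightarrow> f x \<in> P" for P Q
    using that inv by (metis image_subsetI rev_image_eqI subsetI subset_antisym)
  have "f x \<in> Z" if "x \<in> Z" for x
    using UT TU' UT' TU that assms by blast
  then have "bij_betw f Z Z"
    using inv by (intro bij_betw_byWitness[where f' = f]) auto
  moreover have "f ` U = Z - T"
    using UT UT' by (rule img)
  moreover have "f ` T = Z - U"
    using TU TU' by (rule img)
  ultimately show ?thesis by blast
qed

text \<open>In the application \<open>a\<close> and \<open>b\<close> are the end entries of the
  middle row. By \<open>xor\<close> exactly one of \<open>a \<in> U\<close> and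
  \<open>b \<in> T\<close> holds, so removing \<open>a\<close> and \<open>b\<close> lowers the total
  size of \<open>T\<close> and \<open>U\<close> to \<open>2 * h - 1\<close>. This is the size of the
  remaining set, and \<open>ex_complementing_bij\<close> applies there.\<close>

lemma ex_complementing_bij_odd:
  assumes fin: "finite S" and S: "a \<in> S" "b \<in> S" "a \<noteq> b" "T \<subseteq> S" "U \<subseteq> S" "a \<notin> T" "b \<notin> U"
    and card: "card T = h" "card U = h" "card S = 2 * h + 1"
    and xor: "a \<in> U \<longleftrightarrow> b \<notin> T"
  shows "\<exists>f. bij_betw f S S \<and> f ` U = S - insert a T \<and> f ` T = S - insert b U \<and> f a = b \<and> f b = a"
proof -
  let ?Z = "S - {a, b}" and ?T = "T - {b}" and ?U = "U - {a}"
  have finTU: "finite T" "finite U"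
    using fin S finite_subset by auto
  have "card ?Z = 2 * h - 1"
    using S fin card by (simp add: card_Diff_subset)
  moreover have "card ?T + card ?U = 2 * h - 1"
    using xor finTU card by (cases "a \<in> U") (auto simp: card_Diff_singleton)
  ultimately have "card ?T + card ?U = card ?Z" by simp
  moreover have "?T \<subseteq> ?Z" "?U \<subseteq> ?Z" "finite ?Z" using S fin by auto
  ultimately obtain g where g: "bij_betw g ?Z ?Z" "g ` ?U = ?Z - ?T" "g ` ?T = ?Z - ?U"
    using ex_complementing_bij[of ?Z ?T ?U] by metis
  define f where "f = g(a := b, b := a)"
  have fab: "f a = b" "f b = a" using S by (auto simp: f_def)
  have fg: "f ` P = g ` P" if "P \<subseteq> ?Z" for P
    using that by (intro image_cong) (auto simp: f_def)
  have "bij_betw f ?Z ?Z"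
    using g(1) by (subst bij_betw_cong[where g = g]) (auto simp: f_def)
  moreover have "bij_betw f {a, b} {a, b}"
    using S fab by (auto simp: bij_betw_def)
  ultimately have "bij_betw f (?Z \<union> {a, b}) (?Z \<union> {a, b})"
    by (rule bij_betw_combine) auto
  moreover have "?Z \<union> {a, b} = S" using S by auto
  ultimately have "bij_betw f S S" by simp
  moreover have "f ` U = S - insert a T"
  proof -
    have "f ` ?U = ?Z - ?T" using fg[of ?U] g(2) S by auto
    moreover have "f ` U = f ` ?U \<union> (if a \<in> U then {b} else {})" using fab(1) by auto
    ultimately have "f ` U = (?Z - ?T) \<union> (if a \<in> U then {b} else {})" by metis
    also have "\<dots> = S - insert a T" using xor S by auto
    finally show ?thesis .
  qed
  moreover have "f ` T = S - insert b U"
  proof -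
    have "f ` ?T = ?Z - ?U" using fg[of ?T] g(3) S by auto
    moreover have "f ` T = f ` ?T \<union> (if b \<in> T then {a} else {})"
    proof (cases "b \<in> T")
      case True
      then have "T = insert b ?T" by blast
      then have "f ` T = insert (f b) (f ` ?T)" by (metis image_insert)
      then show ?thesis using True fab(2) by simp
    qed simp
    ultimately have "f ` T = (?Z - ?U) \<union> (if b \<in> T then {a} else {})" by metis
    also have "\<dots> = S - insert b U" using xor S by auto
    finally show ?thesis .
  qed
  ultimately show ?thesis using fab by blast
qed

lemma cells_half_odd:
  assumes "n = 2 * h + 1"
  shows "cells n (Suc h) = insert (h, 0) ({..<h} \<times> {..<2})"
proof (rule set_eqI)
  fix x :: "nat \<times> nat"
  obtain j c where x: "x = (j, c)" by force
  consider "c = 0" | "c = 1" | "c \<ge> 2" by linarith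
  then show "x \<in> cells n (Suc h) \<longleftrightarrow> x \<in> insert (h, 0) ({..<h} \<times> {..<2})"
  proof cases
    case 3
    then have "Suc h * 2 \<le> Suc h * c" by (intro mult_le_mono2)
    then show ?thesis using 3 assms by (auto simp: x cells_def)
  qed (use assms in \<open>auto simp: x cells_def\<close>)
qed

lemma cells_half_even:
  assumes "n = 2 * h"
  shows "cells n h = {..<h} \<times> {..<2}"
proof (rule set_eqI)
  fix x :: "nat \<times> nat"
  obtain j c where x: "x = (j, c)" by force
  consider "c = 0" | "c = 1" | "c \<ge> 2" by linarith
  then show "x \<in> cells n h \<longleftrightarrow> x \<in> {..<h} \<times> {..<2}"
  proof cases
    case 3
    then have "h * 2 \<le> h * c" by (intro mult_le_mono2)
    then have "\<not> h * c + j < n" using assms by linarith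
    then show ?thesis using 3 by (simp add: x cells_def)
  qed (use assms in \<open>auto simp: x cells_def\<close>)
qed

text \<open>At half height only the two columns nearest to the border matter; this settles all
  larger heights in \<open>covers_of_view\<close>.\<close>

lemma cells_half:
  "cells n (n - n div 2) =
     {..<n div 2} \<times> {..<2} \<union> (if odd n then {(n div 2, 0)} else {})"
proof (cases "odd n")
  case True
  then have "n = 2 * (n div 2) + 1" by simp
  moreover from this have "n - n div 2 = Suc (n div 2)" by linarith
  ultimately show ?thesis using cells_half_odd[of n "n div 2"] True by simp
next
  case False
  then have "n = 2 * (n div 2)" by simp
  moreover from this have "n - n div 2 = n div 2" by linarith
  ultimately show ?thesis using cells_half_even[of n "n div 2"] False by simp
qed

lemma covers_one:
  assumes "bij_betw (A 0) {..<n} {..<n}"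
  shows "covers n A 1" "covers n (mirror n A) 1"
proof -
  have ex: "\<exists>c<n. A 0 c = s" if "s < n" for s
  proof -
    have "s \<in> A 0 ` {..<n}" using assms that by (simp add: bij_betw_def)
    then show ?thesis by auto
  qed
  then show "covers n A 1"
    by (intro coversI) auto
  show "covers n (mirror n A) 1"
  proof (rule coversI)
    fix s assume "s < n"
    with ex obtain c where "c < n" "A 0 c = s" by blast
    then have "1 * (n - 1 - c) < n" "mirror n A 0 (n - 1 - c) = s"
      by (auto simp: mirror_def)
    then show "\<exists>r<1. \<exists>c. 1 * c < n \<and> mirror n A r c = s" by blast
  qed
qed

text \<open>The last condition is the one required by \<open>ex_complementing_bij_odd\<close>. Exchanging the two outermost right entries of the
  row in which the first entry of the middle row reappears on the right toggles it.\<close>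

lemma ex_top_half_odd:
  assumes n: "n = 2 * h + 1" and h: "h \<ge> 2"
  shows "\<exists>A. (\<forall>j<Suc h. bij_betw (A j) {..<n} {..<n}) \<and>
    (\<forall>i\<in>{2..h}. covers n A i \<and> covers n (mirror n A) i) \<and>
    bij_betw (\<lambda>(j, c). A j c) (cells n (Suc h)) {..<n} \<and>
    bij_betw (\<lambda>(j, c). mirror n A j c) (cells n (Suc h)) {..<n} \<and>
    (A h 0 \<in> (\<lambda>j. mirror n A j 0) ` {..<h} \<longleftrightarrow> mirror n A h 0 \<notin> (\<lambda>j. A j 0) ` {..<h})"
proof -
  have cells: "cells n (Suc h) = insert (h, 0) ({..<h} \<times> {..<2})"
    using n by (rule cells_half_odd)
  obtain A where rows: "\<And>j. j < Suc h \<Longrightarrow> bij_betw (A j) {..<n} {..<n}"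
    and cov: "\<And>i. i \<in> {2..h} \<Longrightarrow> covers n A i \<and> covers n (mirror n A) i"
    and bA: "bij_betw (\<lambda>(j, c). A j c) (cells n (Suc h)) {..<n}"
    and bM: "bij_betw (\<lambda>(j, c). mirror n A j c) (cells n (Suc h)) {..<n}"
  proof -
    have "n \<ge> 4" "h = n div 2" "Suc h = n - h" using n h by auto
    from ex_top_half[OF this] obtain A where "\<forall>j<Suc h. bij_betw (A j) {..<n} {..<n}"
      "\<forall>i\<in>{2..Suc h}. covers n A i \<and> covers n (mirror n A) i"
      "bij_betw (\<lambda>(j, c). A j c) (cells n (Suc h)) {..<n}"
      "bij_betw (\<lambda>(j, c). mirror n A j c) (cells n (Suc h)) {..<n}"
      by blast
    then show ?thesis by (intro that[of A]) simp_all
  qed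
  let ?U = "\<lambda>A. (\<lambda>j. mirror n A j 0) ` {..<h}" and ?T = "\<lambda>A. (\<lambda>j. A j (0::nat)) ` {..<h}"
  show ?thesis
  proof (cases "A h 0 \<in> ?U A \<longleftrightarrow> mirror n A h 0 \<notin> ?T A")
    case True
    then show ?thesis using rows cov bA bM by blast
  next
    case False
    have injM: "j = k \<and> c = d"
      if "mirror n A j c = mirror n A k d" "(j, c) \<in> cells n (Suc h)" "(k, d) \<in> cells n (Suc h)" for j c k d
      using that inj_onD[OF bij_betw_imp_inj_on[OF bM], of "(j, c)" "(k, d)"] by simp
    have "A h 0 < n"
      using bA by (auto simp: bij_betw_def cells)
    then obtain j0 c0 where j0c0: "(j0, c0) \<in> cells n (Suc h)" "A h 0 = mirror n A j0 c0"
    proof -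
      have "A h 0 \<in> (\<lambda>(j, c). mirror n A j c) ` cells n (Suc h)"
        using \<open>A h 0 < n\<close> bij_betw_imp_surj_on[OF bM] by simp
      then show ?thesis using that by auto
    qed
    have "A h 0 \<noteq> mirror n A h 0"
      using inj_onD[OF bij_betw_imp_inj_on[OF rows[of h]], of 0 "n - 1"] n h by (auto simp: mirror_def)
    with j0c0 have j0: "j0 < h" and c0: "c0 < 2"
      by (auto simp: cells)
    \<comment> \<open>\<open>e\<close> exchanges the last two columns, that is, the distances 0 and
      1 from the right border.\<close>
    define e where "e = (\<lambda>c. n - 1 - swap01 (n - 1 - c))"
    define A' where "A' = A(j0 := \<lambda>c. A j0 (e c))"
    have e_less: "e c < n" for c using n by (simp add: e_def)
    have e_e: "e (e c) = c" if "c < n" for c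
      using that n h by (auto simp: e_def swap01_def)
    have e_id: "e c = c" if "c + 2 < n" for c
      using that by (auto simp: e_def swap01_def)
    have A'_eq: "A' j c = A j c" if "c + 2 < n" for j c
      using e_id[OF that] by (simp add: A'_def)
    have M': "mirror n A' j c = mirror n A j (if j = j0 then swap01 c else c)" if "c < n" for j c
      using that n h by (auto simp: A'_def mirror_def e_def)
    have "bij_betw e {..<n} {..<n}"
      using e_e e_less by (intro bij_betw_byWitness[where f' = e]) auto
    then have "bij_betw (A j0 \<circ> e) {..<n} {..<n}"
      using rows[of j0] j0 by (auto intro: bij_betw_trans)
    then have rows': "bij_betw (A' j) {..<n} {..<n}" if "j < Suc h" for j
      using rows[OF that] by (auto simp: A'_def comp_def)
    have cov': "covers n A' i \<and> covers n (mirror n A') i" if i: "i \<in> {2..h}" for i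
    proof
      show "covers n A' i"
      proof (rule covers_cong[OF cov[OF i, THEN conjunct1]])
        fix r c :: nat assume "i * c < n"
        moreover have "2 * c \<le> i * c" using i by simp
        \<comment> \<open>For heights of at least 2 the left rectangles do not reach the last two
          columns.\<close>
        ultimately show "A' r c = A r c" using n h by (intro A'_eq) linarith
      qed
      show "covers n (mirror n A') i"
      proof (rule coversI)
        fix s assume "s < n"
        then obtain r c where rc: "r < i" "i * c < n" "mirror n A r c = s"
          using coversE[OF cov[OF i, THEN conjunct2]] by blast
        let ?c = "if r = j0 then swap01 c else c"
        \<comment> \<open>The distances 0 and 1 both lie in the right rectangle because
          \<open>i \<le> h\<close>, so exchanging them keeps the entry inside.\<close>
        have "i * ?c < n" using rc(2) i n by (auto simp: swap01_def)
        moreover have "mirror n A' r ?c = s"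
        proof -
          have "?c \<le> i * ?c" using i mult_le_mono1[of 1 i ?c] by simp
          then have "?c < n" using \<open>i * ?c < n\<close> by (rule le_less_trans)
          moreover have "swap01 (swap01 c) = c" by (simp add: swap01_def)
          ultimately show ?thesis
            using rc(3) M'[of ?c r] by (cases "r = j0") simp_all
        qed
        ultimately show "\<exists>r<i. \<exists>c. i * c < n \<and> mirror n A' r c = s"
          using rc(1) by blast
      qed
    qed
    have col: "c + 2 < n" if "(j, c) \<in> cells n (Suc h)" for j c
    proof -
      have "c < 2" using that by (auto simp: cells)
      then show ?thesis using n h by linarith
    qed
    have bA': "bij_betw (\<lambda>(j, c). A' j c) (cells n (Suc h)) {..<n}"
    proof -
      have "A' j c = A j c" if "(j, c) \<in> cells n (Suc h)" for j c
        using col[OF that] by (rule A'_eq)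
      then show ?thesis
        using bA by (subst bij_betw_cong[where g = "\<lambda>(j, c). A j c"]) auto
    qed
    have bM': "bij_betw (\<lambda>(j, c). mirror n A' j c) (cells n (Suc h)) {..<n}"
    proof -
      let ?w = "\<lambda>(j, c). (j :: nat, if j = j0 then swap01 c else c)"
      have "bij_betw ?w (cells n (Suc h)) (cells n (Suc h))"
        using j0 by (intro bij_betw_byWitness[where f' = ?w]) (auto simp: cells swap01_def split: if_splits)
      then have "bij_betw ((\<lambda>(j, c). mirror n A j c) \<circ> ?w) (cells n (Suc h)) {..<n}"
        using bM by (rule bij_betw_trans)
      moreover have "mirror n A' j c = mirror n A j (if j = j0 then swap01 c else c)"
        if "(j, c) \<in> cells n (Suc h)" for j c
        using col[OF that] by (intro M') simp
      ultimately show ?thesis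
        by (subst bij_betw_cong[where g = "(\<lambda>(j, c). mirror n A j c) \<circ> ?w"]) auto
    qed
    have M0: "mirror n A' j 0 = mirror n A j (if j = j0 then 1 else 0)" for j
      using M'[of 0 j] n by (simp add: swap01_def)
    \<comment> \<open>The exchange turns membership of \<open>A h 0\<close> in the outer right
      column from \<open>c0 = 0\<close> into \<open>c0 = 1\<close>, while the other side of the
      equivalence does not change.\<close>
    have "A h 0 \<in> ?U A \<longleftrightarrow> c0 = 0"
      using injM[of _ 0 j0 c0] j0c0 j0 by (auto simp: cells)
    moreover have "A h 0 \<in> ?U A' \<longleftrightarrow> c0 = 1"
    proof
      assume "A h 0 \<in> ?U A'"
      then obtain j where j: "j < h" "mirror n A j0 c0 = mirror n A j (if j = j0 then 1 else 0)"
        using j0c0 M0 by auto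
      then show "c0 = 1"
        using injM[of j0 c0 j "if j = j0 then 1 else 0"] j0c0(1) by (auto simp: cells split: if_splits)
    next
      assume "c0 = 1"
      then have "A h 0 = mirror n A' j0 0"
        using j0c0 M0 by simp
      then show "A h 0 \<in> ?U A'" using j0 by blast
    qed
    moreover have "A' h 0 = A h 0" "mirror n A' h 0 = mirror n A h 0" "?T A' = ?T A"
      using A'_eq n h j0 M0 by auto
    ultimately have "A' h 0 \<in> ?U A' \<longleftrightarrow> mirror n A' h 0 \<notin> ?T A'"
      using False c0 by auto
    then show ?thesis using rows' cov' bA' bM' by blast
  qed
qed

text \<open>For \<open>h < i < n\<close> the rectangle contains the two outer columns, hence all
  distinguished entries of the half; for \<open>i = n\<close> it is the outer column alone, handled
  by \<open>col\<close>.\<close>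

lemma covers_of_half:
  assumes n: "n \<ge> 1" and h: "h = n div 2"
    and cov: "\<And>i. i \<in> {1..h} \<Longrightarrow> covers n V i"
    and half: "\<And>s. s < n \<Longrightarrow> (\<exists>j<h. \<exists>c<2. V j c = s) \<or> odd n \<and> V h 0 = s"
    and col: "\<And>s. s < n \<Longrightarrow> \<exists>r<n. V r 0 = s"
    and i: "i \<in> {1..n}"
  shows "covers n V i"
proof -
  consider "i \<le> h" | "i = n" | "h < i" "i < n" using i by force
  then show ?thesis
  proof cases
    case 1
    then show ?thesis using cov i by simp
  next
    case 2
    have "n * 0 < n" using n by simp
    then show ?thesis using col unfolding 2 by (intro coversI) blast
  next
    case 3
    show ?thesis
    proof (rule coversI)
      fix s assume "s < n"
      from half[OF this] obtain j c where "j < i" "c < 2" "V j c = s"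
        using 3 by (metis less_trans zero_less_numeral)
      moreover from this have "i * c < n" using 3 by (auto simp: less_2_cases_iff)
      ultimately show "\<exists>r<i. \<exists>c. i * c < n \<and> V r c = s" by blast
    qed
  qed
qed

text \<open>\<open>V\<close> is the finished array seen from one corner, \<open>W\<close> the upper
  half seen from the corresponding side, and \<open>f\<close> the renaming between them. Renaming by
  a bijection preserves covering.\<close>

lemma covers_of_view:
  assumes n: "n \<ge> 2" and h: "h = n div 2"
    and cov: "\<And>i. i \<in> {1..h} \<Longrightarrow> covers n W i"
    and W: "bij_betw (\<lambda>(j, c). W j c) (cells n (n - h)) {..<n}"
    and f: "bij_betw f {..<n} {..<n}"
    and V: "\<And>j c. j < h \<Longrightarrow> c < n \<Longrightarrow> V j c = f (W j c)" "odd n \<Longrightarrow> V h 0 = f (W h 0)"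
    and col: "\<And>s. s < n \<Longrightarrow> \<exists>r<n. V r 0 = s"
    and i: "i \<in> {1..n}"
  shows "covers n V i"
proof -
  have f_onto: "\<exists>t<n. f t = s" if "s < n" for s
  proof -
    have "s \<in> f ` {..<n}" using f that by (simp add: bij_betw_def)
    then show ?thesis by auto
  qed
  have 1: "covers n V i" if i: "i \<in> {1..h}" for i
  proof (rule coversI)
    fix s assume "s < n"
    with f_onto obtain t where t: "t < n" "f t = s" by blast
    obtain r c where rc: "r < i" "i * c < n" "W r c = t"
      using coversE[OF cov[OF i] t(1)] .
    have "c < n" using rc(2) i by (metis atLeastAtMost_iff le_less_trans mult_le_mono1 nat_mult_1)
    then show "\<exists>r<i. \<exists>c. i * c < n \<and> V r c = s"
      using rc t V(1)[of r c] i by auto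
  qed
  have 2: "(\<exists>j<h. \<exists>c<2. V j c = s) \<or> odd n \<and> V h 0 = s" if s: "s < n" for s
  proof -
    from s f_onto obtain t where t: "t < n" "f t = s" by blast
    then have "t \<in> (\<lambda>(j, c). W j c) ` cells n (n - h)"
      using W by (auto simp: bij_betw_def)
    then obtain j c where "(j, c) \<in> cells n (n - h)" "W j c = t" by auto
    then have "j < h \<and> c < 2 \<and> W j c = t \<or> odd n \<and> W h 0 = t"
      unfolding h cells_half by (auto split: if_splits)
    then show ?thesis using V n t by (metis less_le_trans)
  qed
  have "n \<ge> 1" using n by simp
  then show ?thesis using h 1 2 col i by (rule covers_of_half)
qed

section \<open>The four corners and the return to numbering from 1\<close>

definition flip :: "nat \<Rightarrow> (nat \<Rightarrow> nat \<Rightarrow> nat) \<Rightarrow> nat \<Rightarrow> nat \<Rightarrow> nat" where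
  "flip n A = (\<lambda>r c. A (n - 1 - r) c)"

lemma less_rect_width:
  assumes "i \<ge> 1"
  shows "c < rect_width n i \<longleftrightarrow> i * c < n"
proof -
  have "c < rect_width n i \<longleftrightarrow> real c < real n / real i"
    unfolding rect_width_def by (simp add: zless_nat_eq_int_zless less_ceiling_iff)
  also have "\<dots> \<longleftrightarrow> real (i * c) < real n"
    using assms by (simp add: field_simps)
  finally show ?thesis
    unfolding of_nat_less_iff .
qed

text \<open>One statement for all four corners: \<open>f\<close> translates places seen from a
  corner into places of the array.\<close>

lemma contains_all_symbols_shift:
  assumes "covers n V i" "i \<ge> 1"
    and f: "\<And>r c. r < i \<Longrightarrow> c < n \<Longrightarrow> c < rect_width n i \<Longrightarrow>
      \<exists>r'\<in>R. \<exists>c'\<in>C. A r' c' = Suc (V r c)"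
  shows "contains_all_symbols n A R C"
  unfolding contains_all_symbols_def
proof
  fix s assume s: "s \<in> {1..n}"
  then have "s - 1 < n" by auto
  then obtain r c where rc: "r < i" "i * c < n" "V r c = s - 1"
    by (rule coversE[OF assms(1)])
  have "c < n" using rc(2) assms(2) by (metis le_less_trans mult_le_mono1 nat_mult_1)
  then have "\<exists>r'\<in>R. \<exists>c'\<in>C. A r' c' = Suc (s - 1)"
    using f[of r c] rc less_rect_width[OF assms(2)] by simp
  then show "\<exists>r\<in>R. \<exists>c\<in>C. A r c = s" using s by simp
qed

lemma rpa_type1234_shift:
  assumes rows: "\<And>r. r < n \<Longrightarrow> bij_betw (B r) {..<n} {..<n}"
    and cov: "\<And>i. i \<in> {1..n} \<Longrightarrow> covers n B i" "\<And>i. i \<in> {1..n} \<Longrightarrow> covers n (mirror n B) i"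
      "\<And>i. i \<in> {1..n} \<Longrightarrow> covers n (flip n B) i" "\<And>i. i \<in> {1..n} \<Longrightarrow> covers n (flip n (mirror n B)) i"
  shows "rpa_type1234 n (\<lambda>r c. Suc (B (r - 1) (c - 1)))" (is "rpa_type1234 n ?A")
proof -
  have perm: "rows_are_permutations n ?A"
    unfolding rows_are_permutations_def
  proof
    fix r assume r: "r \<in> {1..n}"
    have "bij_betw (\<lambda>c. c - 1) {1..n} {..<n}"
      by (rule bij_betw_byWitness[where f' = Suc]) auto
    moreover have "bij_betw (B (r - 1)) {..<n} {..<n}"
      using r by (intro rows) auto
    moreover have "bij_betw Suc {..<n} {1..n}"
      by (rule bij_betw_byWitness[where f' = "\<lambda>c. c - 1"]) auto
    ultimately have "bij_betw (Suc \<circ> (B (r - 1) \<circ> (\<lambda>c. c - 1))) {1..n} {1..n}"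
      by (meson bij_betw_trans)
    then show "bij_betw (?A r) {1..n} {1..n}" by (simp add: comp_def)
  qed
  have "contains_all_symbols n ?A {1..i} {1..rect_width n i}" if "i \<in> {1..n}" for i
  proof (rule contains_all_symbols_shift[OF cov(1)[OF that]])
    fix r c assume "r < i" "c < rect_width n i"
    then have "Suc r \<in> {1..i}" "Suc c \<in> {1..rect_width n i}" by auto
    then show "\<exists>r'\<in>{1..i}. \<exists>c'\<in>{1..rect_width n i}. ?A r' c' = Suc (B r c)"
      by (intro bexI[of _ "Suc r"] bexI[of _ "Suc c"]) simp_all
  qed (use that in simp)
  moreover have "contains_all_symbols n ?A {1..i} {n - rect_width n i<..n}" if "i \<in> {1..n}" for i
  proof (rule contains_all_symbols_shift[OF cov(2)[OF that]])
    fix r c assume "r < i" "c < n" "c < rect_width n i"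
    then have "Suc r \<in> {1..i}" "n - c \<in> {n - rect_width n i<..n}" by auto
    then show "\<exists>r'\<in>{1..i}. \<exists>c'\<in>{n - rect_width n i<..n}. ?A r' c' = Suc (mirror n B r c)"
      by (intro bexI[of _ "Suc r"] bexI[of _ "n - c"]) (simp_all add: mirror_def)
  qed (use that in simp)
  moreover have "contains_all_symbols n ?A {n - i<..n} {1..rect_width n i}" if "i \<in> {1..n}" for i
  proof (rule contains_all_symbols_shift[OF cov(3)[OF that]])
    fix r c assume "r < i" "c < rect_width n i"
    then have "n - r \<in> {n - i<..n}" "Suc c \<in> {1..rect_width n i}" using that by auto
    then show "\<exists>r'\<in>{n - i<..n}. \<exists>c'\<in>{1..rect_width n i}. ?A r' c' = Suc (flip n B r c)"
      by (intro bexI[of _ "n - r"] bexI[of _ "Suc c"]) (simp_all add: flip_def)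
  qed (use that in simp)
  moreover have "contains_all_symbols n ?A {n - i<..n} {n - rect_width n i<..n}" if "i \<in> {1..n}" for i
  proof (rule contains_all_symbols_shift[OF cov(4)[OF that]])
    fix r c assume "r < i" "c < n" "c < rect_width n i"
    then have "n - r \<in> {n - i<..n}" "n - c \<in> {n - rect_width n i<..n}" using that by auto
    then show "\<exists>r'\<in>{n - i<..n}. \<exists>c'\<in>{n - rect_width n i<..n}. ?A r' c' = Suc (flip n (mirror n B) r c)"
      by (intro bexI[of _ "n - r"] bexI[of _ "n - c"]) (simp_all add: flip_def mirror_def)
  qed (use that in simp)
  ultimately show ?thesis
    using perm
    by (simp add: rpa_type1234_def rpa_type1_def rpa_type2_def rpa_type3_def rpa_type4_def)
qed

text \<open>Rotation carries the last column of the upper half into the first column of the lower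
  half, and conversely. By \<open>fU\<close> and \<open>fT\<close> the renamed entries are just the
  symbols still missing there. For odd \<open>n\<close> the middle row is not renamed, and
  \<open>mid\<close> makes its end entries fit the lower views.\<close>

lemma rpa_of_top_half:
  assumes n: "n \<ge> 2" and h: "h = n div 2"
    and rows: "\<And>j. j < n - h \<Longrightarrow> bij_betw (A j) {..<n} {..<n}"
    and cov: "\<And>i. i \<in> {2..h} \<Longrightarrow> covers n A i \<and> covers n (mirror n A) i"
    and bA: "bij_betw (\<lambda>(j, c). A j c) (cells n (n - h)) {..<n}"
    and bM: "bij_betw (\<lambda>(j, c). mirror n A j c) (cells n (n - h)) {..<n}"
    and f: "bij_betw f {..<n} {..<n}"
    and fU: "f ` (\<lambda>j. mirror n A j 0) ` {..<h} = {..<n} - (\<lambda>j. A j 0) ` {..<n - h}"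
    and fT: "f ` (\<lambda>j. A j 0) ` {..<h} = {..<n} - (\<lambda>j. mirror n A j 0) ` {..<n - h}"
    and mid: "odd n \<Longrightarrow> f (A h 0) = mirror n A h 0" "odd n \<Longrightarrow> f (mirror n A h 0) = A h 0"
  shows "\<exists>A. rpa_type1234 n A"
proof -
  define B where "B = (\<lambda>r c. if r < n - h then A r c else f (A (n - 1 - r) (n - 1 - c)))"
  have top: "B r c = A r c" "mirror n B r c = mirror n A r c" if "r < n - h" for r c
    using that by (simp_all add: B_def mirror_def)
  have bottom: "flip n B r c = f (mirror n A r c)" if "r < h" for r c
    using that h by (auto simp: B_def mirror_def flip_def)
  have bottom': "flip n (mirror n B) r c = f (A r c)" if "r < h" "c < n" for r c
    using that h by (auto simp: B_def mirror_def flip_def)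
  have cov1: "covers n A i" "covers n (mirror n A) i" if "i \<in> {1..h}" for i
  proof -
    have "bij_betw (A 0) {..<n} {..<n}" using n h by (intro rows) auto
    then show "covers n A i" "covers n (mirror n A) i"
      using covers_one[of A n] cov[of i] that by (cases "i = 1"; force)+
  qed
  have midrow: "odd n \<Longrightarrow> h < n - h \<and> n - 1 - h = h"
    using h by (auto elim!: oddE)
  have hle: "h \<le> n - h" using h by linarith
  have fid: "bij_betw id {..<n} {..<n}" by simp
  have flip_flip: "flip n (flip n X) r c = X r c" if "r < n" for X r c
    using that by (simp add: flip_def)
  have flip_ex: "\<exists>r<n. flip n X r 0 = s" if "\<exists>r<n. X r 0 = s" for X s
  proof -
    from that obtain r where "r < n" "X r 0 = s" by blast
    then show ?thesis by (intro exI[of _ "n - 1 - r"]) (auto simp: flip_def)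
  qed
  have col: "\<exists>r<n. B r 0 = s" if s: "s < n" for s
  proof (cases "s \<in> (\<lambda>j. A j 0) ` {..<n - h}")
    case True
    then obtain j where "j < n - h" "A j 0 = s" by auto
    then show ?thesis using top(1)[of j 0] by (intro exI[of _ j]) simp
  next
    case False
    with s fU have "s \<in> f ` (\<lambda>j. mirror n A j 0) ` {..<h}" by blast
    then obtain j where "j < h" "f (mirror n A j 0) = s" by auto
    then have "\<exists>r<n. flip n B r 0 = s"
      using bottom[of j 0] hle by (intro exI[of _ j]) simp
    then have "\<exists>r<n. flip n (flip n B) r 0 = s" by (rule flip_ex)
    then show ?thesis using flip_flip by metis
  qed
  have col': "\<exists>r<n. mirror n B r 0 = s" if s: "s < n" for s
  proof (cases "s \<in> (\<lambda>j. mirror n A j 0) ` {..<n - h}")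
    case True
    then obtain j where "j < n - h" "mirror n A j 0 = s" by auto
    then show ?thesis using top(2)[of j 0] by (intro exI[of _ j]) simp
  next
    case False
    with s fT have "s \<in> f ` (\<lambda>j. A j 0) ` {..<h}" by blast
    then obtain j where "j < h" "f (A j 0) = s" by auto
    then have "\<exists>r<n. flip n (mirror n B) r 0 = s"
      using bottom'[of j 0] hle n by (intro exI[of _ j]) simp
    then have "\<exists>r<n. flip n (flip n (mirror n B)) r 0 = s" by (rule flip_ex)
    then show ?thesis using flip_flip by metis
  qed
  have "covers n B i" if "i \<in> {1..n}" for i
  proof (rule covers_of_view[where W = "A" and V = "B" and h = h and f = id])
    show "B h 0 = id ((A) h 0)" if "odd n"
      using midrow[OF that] top by simp
    show "B j c = id ((A) j c)" if "j < h" for j c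
      using that hle top by simp
  qed (use n h cov1 bA col that in auto)
  moreover have "covers n (mirror n B) i" if "i \<in> {1..n}" for i
  proof (rule covers_of_view[where W = "mirror n A" and V = "mirror n B" and h = h and f = id])
    show "mirror n B h 0 = id ((mirror n A) h 0)" if "odd n"
      using midrow[OF that] top by simp
    show "mirror n B j c = id ((mirror n A) j c)" if "j < h" for j c
      using that hle top by simp
  qed (use n h cov1 bM col' that in auto)
  moreover have "covers n (flip n B) i" if "i \<in> {1..n}" for i
  proof (rule covers_of_view[where W = "mirror n A" and V = "flip n B" and h = h and f = f])
    \<comment> \<open>The flip fixes the middle row, so its unrenamed first entry must equal the
      renamed last one.\<close>
    show "flip n B h 0 = f (mirror n A h 0)" if "odd n"
      using midrow[OF that] top(1)[of h 0] mid(2)[OF that] by (simp add: flip_def)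
  qed (use n h cov1 bM f that bottom flip_ex col in auto)
  moreover have "covers n (flip n (mirror n B)) i" if "i \<in> {1..n}" for i
  proof (rule covers_of_view[where W = A and V = "flip n (mirror n B)" and h = h and f = f])
    show "flip n (mirror n B) h 0 = f (A h 0)" if "odd n"
      using midrow[OF that] top(2)[of h 0] mid(1)[OF that] by (simp add: flip_def)
  qed (use n h cov1 bA f that bottom' flip_ex col' in auto)
  moreover have "bij_betw (B r) {..<n} {..<n}" if r: "r < n" for r
  proof (cases "r < n - h")
    case True
    then show ?thesis using rows[OF True] by (simp add: B_def)
  next
    case False
    have "bij_betw (\<lambda>c. n - 1 - c) {..<n} {..<n}"
      by (rule bij_betw_byWitness[where f' = "\<lambda>c. n - 1 - c"]) auto
    moreover have "bij_betw (A (n - 1 - r)) {..<n} {..<n}"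
      using False r h by (intro rows) linarith
    ultimately have "bij_betw (f \<circ> (A (n - 1 - r) \<circ> (\<lambda>c. n - 1 - c))) {..<n} {..<n}"
      using f by (meson bij_betw_trans)
    then show ?thesis using False by (simp add: B_def comp_def)
  qed
  ultimately have "rpa_type1234 n (\<lambda>r c. Suc (B (r - 1) (c - 1)))"
    by (intro rpa_type1234_shift) auto
  then show ?thesis by blast
qed

section \<open>Existence for even, odd and small orders\<close>

lemma first_column:
  assumes "bij_betw (\<lambda>(j, c). W j c) (cells n r) {..<n}" "\<And>j. j \<in> J \<Longrightarrow> (j, 0) \<in> cells n r"
  shows "card ((\<lambda>j. W j (0::nat)) ` J) = card J" "(\<lambda>j. W j 0) ` J \<subseteq> {..<n}"
proof -
  have inj: "inj_on (\<lambda>(j, c). W j c) (cells n r)"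
    using assms(1) by (rule bij_betw_imp_inj_on)
  have "inj_on (\<lambda>j. W j 0) J"
  proof (rule inj_onI)
    fix j k assume "j \<in> J" "k \<in> J" "W j 0 = W k 0"
    then show "j = k" using inj_onD[OF inj, of "(j, 0)" "(k, 0)"] assms(2) by simp
  qed
  then show "card ((\<lambda>j. W j 0) ` J) = card J" by (rule card_image)
  have "(\<lambda>(j, c). W j c) (j, 0) \<in> {..<n}" if "j \<in> J" for j
    using bij_betwE[OF assms(1)] assms(2)[OF that] by blast
  then show "(\<lambda>j. W j 0) ` J \<subseteq> {..<n}" by auto
qed

lemma ex_rpa_even:
  assumes n: "n = 2 * h" and h: "h \<ge> 2"
  shows "\<exists>A. rpa_type1234 n A"
proof -
  have hn: "h = n div 2" "n - h = h" and n4: "n \<ge> 4" using n h by auto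
  obtain A where A: "\<And>j. j < h \<Longrightarrow> bij_betw (A j) {..<n} {..<n}"
    "\<And>i. i \<in> {2..h} \<Longrightarrow> covers n A i \<and> covers n (mirror n A) i"
    "bij_betw (\<lambda>(j, c). A j c) (cells n h) {..<n}"
    "bij_betw (\<lambda>(j, c). mirror n A j c) (cells n h) {..<n}"
    using ex_top_half[OF n4 hn(1) refl] unfolding hn(2) by blast
  have c0: "(j, 0) \<in> cells n h" if "j \<in> {..<h}" for j
    using that n by (simp add: cells_def)
  note T = first_column[of A, where J = "{..<h}", OF A(3) c0] and U = first_column[of "mirror n A", where J = "{..<h}", OF A(4) c0]
  obtain f where f: "bij_betw f {..<n} {..<n}"
    "f ` (\<lambda>j. mirror n A j 0) ` {..<h} = {..<n} - (\<lambda>j. A j 0) ` {..<h}"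
    "f ` (\<lambda>j. A j 0) ` {..<h} = {..<n} - (\<lambda>j. mirror n A j 0) ` {..<h}"
  proof -
    have "card ((\<lambda>j. A j 0) ` {..<h}) + card ((\<lambda>j. mirror n A j 0) ` {..<h}) = card {..<n}"
      using T(1) U(1) n by simp
    then have "\<exists>f. bij_betw f {..<n} {..<n} \<and>
        f ` (\<lambda>j. mirror n A j 0) ` {..<h} = {..<n} - (\<lambda>j. A j 0) ` {..<h} \<and>
        f ` (\<lambda>j. A j 0) ` {..<h} = {..<n} - (\<lambda>j. mirror n A j 0) ` {..<h}"
      using T(2) U(2) by (intro ex_complementing_bij) auto
    then show ?thesis by (elim exE conjE) (rule that)
  qed
  show ?thesis
  proof (rule rpa_of_top_half[of n h A f])
    show "n \<ge> 2" using n4 by simp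
    show "f (A h 0) = mirror n A h 0" "f (mirror n A h 0) = A h 0" if "odd n"
      using that n by simp_all
    show "h = n div 2" by (rule hn(1))
  qed (simp_all only: hn(2) A f)
qed

lemma ex_rpa_odd:
  assumes n: "n = 2 * h + 1" and h: "h \<ge> 2"
  shows "\<exists>A. rpa_type1234 n A"
proof -
  have hn: "h = n div 2" "n - h = Suc h" using n by auto
  obtain A where A: "\<And>j. j < Suc h \<Longrightarrow> bij_betw (A j) {..<n} {..<n}"
    "\<And>i. i \<in> {2..h} \<Longrightarrow> covers n A i \<and> covers n (mirror n A) i"
    "bij_betw (\<lambda>(j, c). A j c) (cells n (Suc h)) {..<n}"
    "bij_betw (\<lambda>(j, c). mirror n A j c) (cells n (Suc h)) {..<n}"
    "A h 0 \<in> (\<lambda>j. mirror n A j 0) ` {..<h} \<longleftrightarrow> mirror n A h 0 \<notin> (\<lambda>j. A j 0) ` {..<h}"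
    using ex_top_half_odd[OF n h] by blast
  have c0: "(j, 0) \<in> cells n (Suc h)" if "j \<in> {..<Suc h}" for j
    using that n by (simp add: cells_def)
  have c0': "(j, 0) \<in> cells n (Suc h)" if "j \<in> {..<h}" for j
    using that n by (simp add: cells_def)
  have ins: "W ` {..<Suc h} = insert (W h) (W ` {..<h})" for W :: "nat \<Rightarrow> nat"
    by (simp add: lessThan_Suc)
  note T = first_column[of A, where J = "{..<h}", OF A(3) c0'] and U = first_column[of "mirror n A", where J = "{..<h}", OF A(4) c0']
  note T' = first_column[of A, where J = "{..<Suc h}", OF A(3) c0] and U' = first_column[of "mirror n A", where J = "{..<Suc h}", OF A(4) c0]
  \<comment> \<open>The outer column has \<open>h + 1\<close> distinct entries down to the middle
    row, so the middle entry does not occur above it.\<close>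
  have notin: "W h \<notin> W ` {..<h}" if "card (W ` {..<Suc h}) = card {..<Suc h}" for W :: "nat \<Rightarrow> nat"
  proof
    assume "W h \<in> W ` {..<h}"
    then obtain j where "j < h" "W h = W j" by auto
    then show False
      using inj_onD[OF eq_card_imp_inj_on[OF _ that], of h j] by simp
  qed
  have "A h 0 < n" "mirror n A h 0 < n"
    using T'(2) U'(2) by auto
  moreover have "A h 0 \<noteq> mirror n A h 0"
    using inj_onD[OF bij_betw_imp_inj_on[OF A(1)[of h]], of 0 "n - 1"] n h by (auto simp: mirror_def)
  ultimately obtain f where f: "bij_betw f {..<n} {..<n}"
    "f ` (\<lambda>j. mirror n A j 0) ` {..<h} = {..<n} - insert (A h 0) ((\<lambda>j. A j 0) ` {..<h})"
    "f ` (\<lambda>j. A j 0) ` {..<h} = {..<n} - insert (mirror n A h 0) ((\<lambda>j. mirror n A j 0) ` {..<h})"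
    "f (A h 0) = mirror n A h 0" "f (mirror n A h 0) = A h 0"
    using ex_complementing_bij_odd[of "{..<n}" "A h 0" "mirror n A h 0"
        "(\<lambda>j. A j 0) ` {..<h}" "(\<lambda>j. mirror n A j 0) ` {..<h}" h]
      T U notin[OF T'(1)] notin[OF U'(1)] A(5) n by auto
  show ?thesis
  proof (rule rpa_of_top_half[of n h A f])
    show "n \<ge> 2" using n h by simp
    show "f ` (\<lambda>j. mirror n A j 0) ` {..<h} = {..<n} - (\<lambda>j. A j 0) ` {..<n - h}"
      unfolding hn(2) ins by (rule f(2))
    show "f ` (\<lambda>j. A j 0) ` {..<h} = {..<n} - (\<lambda>j. mirror n A j 0) ` {..<n - h}"
      unfolding hn(2) ins by (rule f(3))
    show "h = n div 2" by (rule hn(1))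
    show "f (A h 0) = mirror n A h 0" "f (mirror n A h 0) = A h 0"
      by (rule f(4), rule f(5))
  qed (simp_all only: hn(2) A(1-4) f(1))
qed

text \<open>The cyclic table works: heights 1 and \<open>n\<close> ask for a full row and a full
  column, which leaves only the 2 by 2 corners for \<open>n = 3\<close>.\<close>

lemma ex_rpa_small:
  assumes "n \<in> {1, 2, 3}"
  shows "\<exists>A. rpa_type1234 n A"
proof -
  define B where "B = (\<lambda>r c. (r + c) mod n)"
  have row: "bij_betw (B r) {..<n} {..<n}" if "r < n" for r
  proof -
    have "inj_on (B r) {..<n}"
    proof (rule linorder_inj_onI)
      fix c d assume "c < d" "c \<in> {..<n}" "d \<in> {..<n}"
      then have "\<not> n dvd (r + d) - (r + c)"
        by (simp add: nat_dvd_not_less)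
      then show "B r c \<noteq> B r d"
        using \<open>c < d\<close> mod_eq_dvd_iff_nat[of "r + c" "r + d" n] by (auto simp: B_def)
    qed auto
    moreover have "B r ` {..<n} \<subseteq> {..<n}"
      using assms by (auto simp: B_def)
    ultimately show ?thesis by (intro bij_betw_imageI endo_inj_surj) auto
  qed
  have witness: "covers n V i"
    if "{..<n} \<subseteq> (\<lambda>(r, c). V r c) ` P" "P \<subseteq> {(r, c). r < i \<and> i * c < n}" for V i P
    using that by (intro coversI) fastforce
  have column: "covers n V n" if "{..<n} \<subseteq> (\<lambda>r. V r 0) ` {..<n}" for V
    using that by (intro witness[of _ "{..<n} \<times> {0}"]) auto
  have small: "{..<1} = {0 :: nat}" "{..<2} = {0, 1 :: nat}" "{..<3} = {0, 1, 2 :: nat}"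
    by auto
  have corner: "covers n V i"
    if "n = 3" "i = 2" "{0, 1, 2} \<subseteq> {V 0 0, V 0 1, V 1 0, V 1 1}" for V i
    using that by (intro witness[of _ "{(0, 0), (0, 1), (1, 0), (1, 1)}"]) (auto simp: small)
  have columns: "covers n B n" "covers n (mirror n B) n" "covers n (flip n B) n" "covers n (flip n (mirror n B)) n"
    using assms by (auto intro!: column simp: small B_def mirror_def flip_def)
  have cov: "covers n B i \<and> covers n (mirror n B) i \<and> covers n (flip n B) i \<and> covers n (flip n (mirror n B)) i"
    if "i \<in> {1..n}" for i
  proof -
    consider "i = n" | "i = 1" | "n = 3" "i = 2" using assms \<open>i \<in> {1..n}\<close> by force
    then show ?thesis
    proof cases
      case 1
      then show ?thesis using columns by simp
    next
      case 2
      have "bij_betw (flip n B 0) {..<n} {..<n}"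
        using row[of "n - 1"] assms by (auto simp: flip_def)
      then have "covers n (flip n B) 1" "covers n (mirror n (flip n B)) 1"
        by (rule covers_one)+
      moreover have "covers n B 1" "covers n (mirror n B) 1"
        using assms by (intro covers_one row; auto)+
      moreover have "mirror n (flip n B) = flip n (mirror n B)"
        by (simp add: mirror_def flip_def)
      ultimately show ?thesis using 2 by simp
    next
      case 3
      then show ?thesis
        by (intro conjI corner) (auto simp: B_def mirror_def flip_def)
    qed
  qed
  then have "rpa_type1234 n (\<lambda>r c. Suc (B (r - 1) (c - 1)))"
    using row cov by (intro rpa_type1234_shift) auto
  then show ?thesis by blast
qed

theorem theorem2p4:
  fixes n :: nat
  assumes "n \<ge> 1"
  shows "\<exists>A :: nat \<Rightarrow> nat \<Rightarrow> nat. rpa_type1234 n A"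
proof (cases "n \<le> 3")
  case True
  then show ?thesis using assms by (intro ex_rpa_small) auto
next
  case False
  show ?thesis
  proof (cases "even n")
    case True
    then obtain h where "n = 2 * h" by (rule evenE)
    then show ?thesis using False by (intro ex_rpa_even) auto
  next
    case odd: False
    then obtain h where "n = 2 * h + 1" by (rule oddE)
    then show ?thesis using False by (intro ex_rpa_odd) auto
  qed
qed

end
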